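(* Let $A$ be an idempotented algebra and let $e\in A$ be a left special idempotent. Then the functor $\mathrm{Hom}_A(Ae,-):\mathsf{M}(A)_e\to\mathsf{M}(eAe)$ is an equivalence of categories, with quasi-inverse $A\otimes_{eAe}(-):\mathsf{M}(eAe)\to\mathsf{M}(A)_e$.
   Context: Algebras are associative $\mathbb{K}$-algebras, not necessarily unital, over a fixed commutative unital ring $\mathbb{K}$. An algebra $A$ is idempotented if for each $a\in A$ there is an idempotent $e\in A$ with $ae=ea=a$, and for any idempotents $e_1,e_2\in A$ there is an idempotent $e\in A$ with $ee_i=e_ie=e_i$ for $i=1,2$. A left $A$-module $M$ is non-degenerate if for every $m\in M$ there is an idempotent $f\in A$ with $fm=m$; $\mathsf{M}(A)$ is the category of non-degenerate left $A$-modules. For an idempotent $e\in A$, $eAe$ is a unital algebra with unit $e$, and $\mathsf{M}(eAe)$ is the category of (unital) left $eAe$-modules. $AeM$ denotes the $A$-submodule of $M$ generated by $eM$. The idempotent $e$ is left special if the full subcategory $\{M\in\mathsf{M}(A)\mid M=AeM\}$ is closed under subquotients. $\mathsf{M}(A)_e$ denotes the full subcategory of all $M\in\mathsf{M}(A)$ such that $e(H/K)\neq 0$ for all submodules $K\subsetneq H\leq M$; when $e$ is left special it coincides with $\{M\in\mathsf{M}(A)\mid M=AeM\}$. The left $eAe$-module structure on $\mathrm{Hom}_A(Ae,M)$ comes from right multiplication on $Ae$; equivalently, under $f\mapsto f(e)$ it is $eM$ with its natural $eAe$-action. *)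

theory Defs
  imports "HOL-Algebra.Module" "HOL-Algebra.AbelCoset"
begin

section \<open>Non-unital algebras\<close>

text \<open>
  An algebra over the commutative ring \<open>K\<close> is a \<^locale>\<open>module\<close> over \<open>K\<close>, together with the
  field \<^const>\<open>mult\<close> of the module record as its product.  There need not be a unit: the
  field \<^const>\<open>one\<close> is ignored.
\<close>

locale nonunital_algebra = module K A
  for K :: "'k ring" and A :: "('k, 'a) module" +
  assumes mult_closed:
      "\<lbrakk>a \<in> carrier A; b \<in> carrier A\<rbrakk> \<Longrightarrow> a \<otimes>\<^bsub>A\<^esub> b \<in> carrier A"
    and mult_assoc:
      "\<lbrakk>a \<in> carrier A; b \<in> carrier A; c \<in> carrier A\<rbrakk>
        \<Longrightarrow> (a \<otimes>\<^bsub>A\<^esub> b) \<otimes>\<^bsub>A\<^esub> c = a \<otimes>\<^bsub>A\<^esub> (b \<otimes>\<^bsub>A\<^esub> c)"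
    and mult_add_left:
      "\<lbrakk>a \<in> carrier A; b \<in> carrier A; c \<in> carrier A\<rbrakk>
        \<Longrightarrow> (a \<oplus>\<^bsub>A\<^esub> b) \<otimes>\<^bsub>A\<^esub> c = a \<otimes>\<^bsub>A\<^esub> c \<oplus>\<^bsub>A\<^esub> b \<otimes>\<^bsub>A\<^esub> c"
    and mult_add_right:
      "\<lbrakk>a \<in> carrier A; b \<in> carrier A; c \<in> carrier A\<rbrakk>
        \<Longrightarrow> a \<otimes>\<^bsub>A\<^esub> (b \<oplus>\<^bsub>A\<^esub> c) = a \<otimes>\<^bsub>A\<^esub> b \<oplus>\<^bsub>A\<^esub> a \<otimes>\<^bsub>A\<^esub> c"
    and smult_mult_left:
      "\<lbrakk>k \<in> carrier K; a \<in> carrier A; b \<in> carrier A\<rbrakk>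
        \<Longrightarrow> (k \<odot>\<^bsub>A\<^esub> a) \<otimes>\<^bsub>A\<^esub> b = k \<odot>\<^bsub>A\<^esub> (a \<otimes>\<^bsub>A\<^esub> b)"
    and smult_mult_right:
      "\<lbrakk>k \<in> carrier K; a \<in> carrier A; b \<in> carrier A\<rbrakk>
        \<Longrightarrow> a \<otimes>\<^bsub>A\<^esub> (k \<odot>\<^bsub>A\<^esub> b) = k \<odot>\<^bsub>A\<^esub> (a \<otimes>\<^bsub>A\<^esub> b)"

definition idempotent_elem :: "('k, 'a) module \<Rightarrow> 'a \<Rightarrow> bool" where
  "idempotent_elem A e \<longleftrightarrow> e \<in> carrier A \<and> e \<otimes>\<^bsub>A\<^esub> e = e"

locale idempotented_algebra = nonunital_algebra K A
  for K :: "'k ring" and A :: "('k, 'a) module" +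
  assumes local_unit:
      "a \<in> carrier A \<Longrightarrow> \<exists>e. idempotent_elem A e \<and> a \<otimes>\<^bsub>A\<^esub> e = a \<and> e \<otimes>\<^bsub>A\<^esub> a = a"
    and common_unit:
      "\<lbrakk>idempotent_elem A e1; idempotent_elem A e2\<rbrakk>
        \<Longrightarrow> \<exists>e. idempotent_elem A e \<and> e \<otimes>\<^bsub>A\<^esub> e1 = e1 \<and> e1 \<otimes>\<^bsub>A\<^esub> e = e1
                \<and> e \<otimes>\<^bsub>A\<^esub> e2 = e2 \<and> e2 \<otimes>\<^bsub>A\<^esub> e = e2"

definition corner :: "('k, 'a) module \<Rightarrow> 'a \<Rightarrow> ('k, 'a) module" where
  "corner A e = A\<lparr>carrier := {e \<otimes>\<^bsub>A\<^esub> a \<otimes>\<^bsub>A\<^esub> e | a. a \<in> carrier A}, one := e\<rparr>"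


section \<open>Left modules\<close>

text \<open>
  A left module over a \<open>K\<close>-algebra is a \<open>K\<close>-module with an additional action of the algebra;
  the fields \<^const>\<open>mult\<close> and \<^const>\<open>one\<close> inherited from the ring record are ignored.
\<close>

record ('k, 'a, 'm) amod = "('k, 'm) module" +
  act :: "'a \<Rightarrow> 'm \<Rightarrow> 'm"

locale left_module = module K M
  for K :: "'k ring" and A :: "('k, 'a) module" and M :: "('k, 'a, 'm) amod" +
  assumes act_closed:
      "\<lbrakk>a \<in> carrier A; m \<in> carrier M\<rbrakk> \<Longrightarrow> act M a m \<in> carrier M"
    and act_add_left:
      "\<lbrakk>a \<in> carrier A; b \<in> carrier A; m \<in> carrier M\<rbrakk>
        \<Longrightarrow> act M (a \<oplus>\<^bsub>A\<^esub> b) m = act M a m \<oplus>\<^bsub>M\<^esub> act M b m"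
    and act_add_right:
      "\<lbrakk>a \<in> carrier A; m \<in> carrier M; n \<in> carrier M\<rbrakk>
        \<Longrightarrow> act M a (m \<oplus>\<^bsub>M\<^esub> n) = act M a m \<oplus>\<^bsub>M\<^esub> act M a n"
    and act_mult:
      "\<lbrakk>a \<in> carrier A; b \<in> carrier A; m \<in> carrier M\<rbrakk>
        \<Longrightarrow> act M (a \<otimes>\<^bsub>A\<^esub> b) m = act M a (act M b m)"
    and act_smult_left:
      "\<lbrakk>k \<in> carrier K; a \<in> carrier A; m \<in> carrier M\<rbrakk>
        \<Longrightarrow> act M (k \<odot>\<^bsub>A\<^esub> a) m = k \<odot>\<^bsub>M\<^esub> act M a m"
    and act_smult_right:
      "\<lbrakk>k \<in> carrier K; a \<in> carrier A; m \<in> carrier M\<rbrakk>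
        \<Longrightarrow> act M a (k \<odot>\<^bsub>M\<^esub> m) = k \<odot>\<^bsub>M\<^esub> act M a m"

definition nondegenerate_module ::
    "'k ring \<Rightarrow> ('k, 'a) module \<Rightarrow> ('k, 'a, 'm) amod \<Rightarrow> bool" where
  "nondegenerate_module K A M \<longleftrightarrow>
     left_module K A M \<and> (\<forall>m\<in>carrier M. \<exists>f. idempotent_elem A f \<and> act M f m = m)"

text \<open>Here \<^const>\<open>one\<close> of the algebra does matter; this is used for \<^term>\<open>corner A e\<close> only.\<close>

definition unital_module ::
    "'k ring \<Rightarrow> ('k, 'a) module \<Rightarrow> ('k, 'a, 'm) amod \<Rightarrow> bool" where
  "unital_module K B M \<longleftrightarrow> left_module K B M \<and> (\<forall>m\<in>carrier M. act M \<one>\<^bsub>B\<^esub> m = m)"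

definition amod_hom ::
    "'k ring \<Rightarrow> ('k, 'a) module \<Rightarrow> ('k, 'a, 'm) amod \<Rightarrow> ('k, 'a, 'n) amod \<Rightarrow> ('m \<Rightarrow> 'n) set" where
  "amod_hom K A M N =
     {f \<in> carrier M \<rightarrow>\<^sub>E carrier N.
        (\<forall>x\<in>carrier M. \<forall>y\<in>carrier M. f (x \<oplus>\<^bsub>M\<^esub> y) = f x \<oplus>\<^bsub>N\<^esub> f y) \<and>
        (\<forall>k\<in>carrier K. \<forall>x\<in>carrier M. f (k \<odot>\<^bsub>M\<^esub> x) = k \<odot>\<^bsub>N\<^esub> f x) \<and>
        (\<forall>a\<in>carrier A. \<forall>x\<in>carrier M. f (act M a x) = act N a (f x))}"

definition asubmodule ::
    "'k ring \<Rightarrow> ('k, 'a) module \<Rightarrow> 'm set \<Rightarrow> ('k, 'a, 'm) amod \<Rightarrow> bool" where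
  "asubmodule K A H M \<longleftrightarrow>
     submodule H K M \<and> (\<forall>a\<in>carrier A. \<forall>h\<in>H. act M a h \<in> H)"

text \<open>The subquotient \<open>H/L\<close> of \<open>M\<close>, for submodules \<open>L \<subseteq> H\<close>.\<close>

definition subquotient ::
    "('k, 'a, 'm) amod \<Rightarrow> 'm set \<Rightarrow> 'm set \<Rightarrow> ('k, 'a, 'm set) amod" where
  "subquotient M H L =
     \<lparr>carrier = A_RCOSETS (M\<lparr>carrier := H\<rparr>) L,
      mult = undefined, one = undefined,
      zero = L,
      add = set_add M,
      smult = (\<lambda>k X. \<Union>x\<in>X. L +>\<^bsub>M\<^esub> (k \<odot>\<^bsub>M\<^esub> x)),
      act = (\<lambda>a X. \<Union>x\<in>X. L +>\<^bsub>M\<^esub> act M a x)\<rparr>"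

text \<open>The carrier of \<open>AeM\<close>.\<close>

definition AeM :: "'k ring \<Rightarrow> ('k, 'a) module \<Rightarrow> 'a \<Rightarrow> ('k, 'a, 'm) amod \<Rightarrow> 'm set" where
  "AeM K A e M = \<Inter>{H. asubmodule K A H M \<and> act M e ` carrier M \<subseteq> H}"

definition generated_module ::
    "'k ring \<Rightarrow> ('k, 'a) module \<Rightarrow> 'a \<Rightarrow> ('k, 'a, 'm) amod \<Rightarrow> bool" where
  "generated_module K A e M \<longleftrightarrow> nondegenerate_module K A M \<and> carrier M = AeM K A e M"


section \<open>The universe of modules\<close>

text \<open>
  To obtain actual categories (with one type of objects each) between which
  \<open>Hom\<^sub>A(Ae, -)\<close> and \<open>A \<otimes> -\<close> are actual functors, all modules under consideration have their
  carrier inside a type that is closed under the two constructions: it contains an arbitrary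
  type \<open>'x\<close> of atoms, all functions from \<open>'a\<close> to itself (for the elements of \<open>Hom\<^sub>A(Ae, M)\<close>) and
  all formal sums of pairs (for the elements of a tensor product).  As \<open>'x\<close> is arbitrary,
  every module is isomorphic to one in a suitable such universe.
\<close>

datatype ('a, 'x) univ =
    Atom 'x
  | Fn "'a \<Rightarrow> ('a, 'x) univ"
  | FSum "('a \<times> ('a, 'x) univ) list"

fun fn_of :: "('a, 'x) univ \<Rightarrow> 'a \<Rightarrow> ('a, 'x) univ" where
  "fn_of (Fn f) = f"
| "fn_of _ = undefined"

fun terms_of :: "('a, 'x) univ \<Rightarrow> ('a \<times> ('a, 'x) univ) list" where
  "terms_of (FSum xs) = xs"
| "terms_of _ = undefined"

type_synonym ('k, 'a, 'x) umod = "('k, 'a, ('a, 'x) univ) amod"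

text \<open>
  The full subcategory of all \<open>M\<close> with \<open>M = AeM\<close> is closed under subquotients.  Whether this
  holds does not depend on \<open>'x\<close>: it can be tested on quotients of finite direct sums of copies
  of \<open>Ae\<close> (a failure for \<open>h \<in> H \<subseteq> M\<close> already occurs inside a finitely generated submodule),
  and for all \<open>'x\<close> the universe is infinite and at least as large as \<open>'a\<close>.
\<close>

definition left_special ::
    "'x itself \<Rightarrow> 'k ring \<Rightarrow> ('k, 'a) module \<Rightarrow> 'a \<Rightarrow> bool" where
  "left_special TYPE('x) K A e \<longleftrightarrow>
     (\<forall>(M :: ('k, 'a, 'x) umod) H L.
        generated_module K A e M \<and> asubmodule K A H M \<and> asubmodule K A L M \<and> L \<subseteq> H
        \<longrightarrow> generated_module K A e (subquotient M H L))"


section \<open>Categories\<close>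

text \<open>The hom-sets of a category need not be disjoint, so composition takes the three objects
  as arguments: \<^term>\<open>Cmp C X Y Z g f\<close> is the composite of \<open>f : X \<rightarrow> Y\<close> and \<open>g : Y \<rightarrow> Z\<close>.\<close>

record ('o, 'm) cat =
  Obj :: "'o set"
  Arr :: "'o \<Rightarrow> 'o \<Rightarrow> 'm set"
  Idn :: "'o \<Rightarrow> 'm"
  Cmp :: "'o \<Rightarrow> 'o \<Rightarrow> 'o \<Rightarrow> 'm \<Rightarrow> 'm \<Rightarrow> 'm"

locale is_category =
  fixes C :: "('o, 'm) cat"
  assumes Idn_Arr: "X \<in> Obj C \<Longrightarrow> Idn C X \<in> Arr C X X"
    and Cmp_Arr:
      "\<lbrakk>X \<in> Obj C; Y \<in> Obj C; Z \<in> Obj C; f \<in> Arr C X Y; g \<in> Arr C Y Z\<rbrakk>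
        \<Longrightarrow> Cmp C X Y Z g f \<in> Arr C X Z"
    and Cmp_Idn_left:
      "\<lbrakk>X \<in> Obj C; Y \<in> Obj C; f \<in> Arr C X Y\<rbrakk> \<Longrightarrow> Cmp C X Y Y (Idn C Y) f = f"
    and Cmp_Idn_right:
      "\<lbrakk>X \<in> Obj C; Y \<in> Obj C; f \<in> Arr C X Y\<rbrakk> \<Longrightarrow> Cmp C X X Y f (Idn C X) = f"
    and Cmp_assoc:
      "\<lbrakk>W \<in> Obj C; X \<in> Obj C; Y \<in> Obj C; Z \<in> Obj C;
        f \<in> Arr C W X; g \<in> Arr C X Y; h \<in> Arr C Y Z\<rbrakk>
        \<Longrightarrow> Cmp C W Y Z h (Cmp C W X Y g f) = Cmp C W X Z (Cmp C X Y Z h g) f"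

record ('o, 'm, 'p, 'n) ftor =
  on_obj :: "'o \<Rightarrow> 'p"
  on_arr :: "'o \<Rightarrow> 'o \<Rightarrow> 'm \<Rightarrow> 'n"

locale is_functor = C: is_category C + D: is_category D
  for C :: "('o, 'm) cat" and D :: "('p, 'n) cat" and F :: "('o, 'm, 'p, 'n) ftor" +
  assumes on_obj_Obj: "X \<in> Obj C \<Longrightarrow> on_obj F X \<in> Obj D"
    and on_arr_Arr:
      "\<lbrakk>X \<in> Obj C; Y \<in> Obj C; f \<in> Arr C X Y\<rbrakk>
        \<Longrightarrow> on_arr F X Y f \<in> Arr D (on_obj F X) (on_obj F Y)"
    and on_arr_Idn: "X \<in> Obj C \<Longrightarrow> on_arr F X X (Idn C X) = Idn D (on_obj F X)"
    and on_arr_Cmp: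
      "\<lbrakk>X \<in> Obj C; Y \<in> Obj C; Z \<in> Obj C; f \<in> Arr C X Y; g \<in> Arr C Y Z\<rbrakk>
        \<Longrightarrow> on_arr F X Z (Cmp C X Y Z g f) =
            Cmp D (on_obj F X) (on_obj F Y) (on_obj F Z) (on_arr F Y Z g) (on_arr F X Y f)"

definition id_ftor :: "('o, 'm, 'o, 'm) ftor" where
  "id_ftor = \<lparr>on_obj = (\<lambda>X. X), on_arr = (\<lambda>X Y f. f)\<rparr>"

definition comp_ftor ::
    "('p, 'n, 'q, 'l) ftor \<Rightarrow> ('o, 'm, 'p, 'n) ftor \<Rightarrow> ('o, 'm, 'q, 'l) ftor" where
  "comp_ftor G F =
     \<lparr>on_obj = (\<lambda>X. on_obj G (on_obj F X)),
      on_arr = (\<lambda>X Y f. on_arr G (on_obj F X) (on_obj F Y) (on_arr F X Y f))\<rparr>"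

definition isomorphism :: "('o, 'm) cat \<Rightarrow> 'o \<Rightarrow> 'o \<Rightarrow> 'm \<Rightarrow> bool" where
  "isomorphism C X Y f \<longleftrightarrow>
     f \<in> Arr C X Y \<and>
     (\<exists>g\<in>Arr C Y X. Cmp C X Y X g f = Idn C X \<and> Cmp C Y X Y f g = Idn C Y)"

definition natural_isomorphism ::
    "('o, 'm) cat \<Rightarrow> ('p, 'n) cat \<Rightarrow> ('o, 'm, 'p, 'n) ftor \<Rightarrow> ('o, 'm, 'p, 'n) ftor
      \<Rightarrow> ('o \<Rightarrow> 'n) \<Rightarrow> bool" where
  "natural_isomorphism C D F G \<eta> \<longleftrightarrow>
     (\<forall>X\<in>Obj C. isomorphism D (on_obj F X) (on_obj G X) (\<eta> X)) \<and>
     (\<forall>X\<in>Obj C. \<forall>Y\<in>Obj C. \<forall>f\<in>Arr C X Y.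
        Cmp D (on_obj F X) (on_obj F Y) (on_obj G Y) (\<eta> Y) (on_arr F X Y f) =
        Cmp D (on_obj F X) (on_obj G X) (on_obj G Y) (on_arr G X Y f) (\<eta> X))"

definition equivalence_with_quasi_inverse ::
    "('o, 'm) cat \<Rightarrow> ('p, 'n) cat \<Rightarrow> ('o, 'm, 'p, 'n) ftor \<Rightarrow> ('p, 'n, 'o, 'm) ftor \<Rightarrow> bool" where
  "equivalence_with_quasi_inverse C D F G \<longleftrightarrow>
     is_functor C D F \<and> is_functor D C G \<and>
     (\<exists>\<eta>. natural_isomorphism C C (comp_ftor G F) id_ftor \<eta>) \<and>
     (\<exists>\<epsilon>. natural_isomorphism D D (comp_ftor F G) id_ftor \<epsilon>)"


section \<open>The categories \<open>M(A)\<^sub>e\<close> and \<open>M(eAe)\<close>\<close>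

definition full_module_category ::
    "'k ring \<Rightarrow> ('k, 'a) module \<Rightarrow> ('k, 'a, 'm) amod set \<Rightarrow> (('k, 'a, 'm) amod, 'm \<Rightarrow> 'm) cat" where
  "full_module_category K A Ms =
     \<lparr>Obj = Ms,
      Arr = amod_hom K A,
      Idn = (\<lambda>M. \<lambda>x\<in>carrier M. x),
      Cmp = (\<lambda>M N P g f. compose (carrier M) g f)\<rparr>"

definition Mod_e ::
    "'k ring \<Rightarrow> ('k, 'a) module \<Rightarrow> 'a \<Rightarrow>
      (('k, 'a, 'x) umod, ('a, 'x) univ \<Rightarrow> ('a, 'x) univ) cat" where
  "Mod_e K A e = full_module_category K A
     {M. nondegenerate_module K A M \<and>
         (\<forall>H L. asubmodule K A H M \<and> asubmodule K A L M \<and> L \<subset> H \<longrightarrow>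
            (let Q = subquotient M H L in \<exists>q\<in>carrier Q. act Q e q \<noteq> \<zero>\<^bsub>Q\<^esub>))}"

definition Mod_corner ::
    "'k ring \<Rightarrow> ('k, 'a) module \<Rightarrow> 'a \<Rightarrow>
      (('k, 'a, 'x) umod, ('a, 'x) univ \<Rightarrow> ('a, 'x) univ) cat" where
  "Mod_corner K A e = full_module_category K (corner A e) {N. unital_module K (corner A e) N}"


section \<open>The functor \<open>Hom\<^sub>A(Ae, -)\<close>\<close>

definition Ae_module :: "('k, 'a) module \<Rightarrow> 'a \<Rightarrow> ('k, 'a, 'a) amod" where
  "Ae_module A e =
     \<lparr>carrier = {a \<otimes>\<^bsub>A\<^esub> e | a. a \<in> carrier A},
      mult = undefined, one = undefined,
      zero = \<zero>\<^bsub>A\<^esub>, add = add A, smult = smult A, act = mult A\<rparr>"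

definition Hom_Ae :: "'k ring \<Rightarrow> ('k, 'a) module \<Rightarrow> 'a \<Rightarrow> ('k, 'a, 'x) umod \<Rightarrow> ('k, 'a, 'x) umod" where
  "Hom_Ae K A e M = (let P = carrier (Ae_module A e) in
     \<lparr>carrier = Fn ` amod_hom K A (Ae_module A e) M,
      mult = undefined, one = undefined,
      zero = Fn (\<lambda>x\<in>P. \<zero>\<^bsub>M\<^esub>),
      add = (\<lambda>u v. Fn (\<lambda>x\<in>P. fn_of u x \<oplus>\<^bsub>M\<^esub> fn_of v x)),
      smult = (\<lambda>k u. Fn (\<lambda>x\<in>P. k \<odot>\<^bsub>M\<^esub> fn_of u x)),
      act = (\<lambda>b u. Fn (\<lambda>x\<in>P. fn_of u (x \<otimes>\<^bsub>A\<^esub> b)))\<rparr>)"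

definition Hom_functor ::
    "'k ring \<Rightarrow> ('k, 'a) module \<Rightarrow> 'a \<Rightarrow>
      (('k, 'a, 'x) umod, ('a, 'x) univ \<Rightarrow> ('a, 'x) univ,
       ('k, 'a, 'x) umod, ('a, 'x) univ \<Rightarrow> ('a, 'x) univ) ftor" where
  "Hom_functor K A e =
     \<lparr>on_obj = Hom_Ae K A e,
      on_arr = (\<lambda>M N f. \<lambda>u\<in>carrier (Hom_Ae K A e M).
                  Fn (compose (carrier (Ae_module A e)) f (fn_of u)))\<rparr>"


section \<open>The functor \<open>A \<otimes>\<^bsub>eAe\<^esub> -\<close>\<close>

text \<open>
  Let \<open>B\<close> be a subalgebra of \<open>A\<close>, so that \<open>A\<close> is a right \<open>B\<close>-module.  The list
  \<open>[(a\<^sub>1, n\<^sub>1), \<dots>, (a\<^sub>r, n\<^sub>r)]\<close> stands for the sum of the \<open>a\<^sub>i \<otimes> n\<^sub>i\<close> in \<open>A \<otimes>\<^sub>B N\<close>, and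
  \<open>tensor_eq A B N\<close> is equality of such sums: the least congruence for concatenation that
  contains commutativity and the defining relations.  Negatives need not be added formally,
  because \<open>-(a \<otimes> n) = (-a) \<otimes> n\<close>.
\<close>

inductive tensor_eq ::
    "('k, 'a) module \<Rightarrow> ('k, 'a) module \<Rightarrow> ('k, 'a, 'n) amod \<Rightarrow> ('a \<times> 'n) list \<Rightarrow> ('a \<times> 'n) list \<Rightarrow> bool"
  for A B N where
  tensor_refl: "tensor_eq A B N xs xs"
| tensor_sym: "tensor_eq A B N xs ys \<Longrightarrow> tensor_eq A B N ys xs"
| tensor_trans: "\<lbrakk>tensor_eq A B N xs ys; tensor_eq A B N ys zs\<rbrakk> \<Longrightarrow> tensor_eq A B N xs zs"
| tensor_append:
    "\<lbrakk>tensor_eq A B N xs xs'; tensor_eq A B N ys ys'\<rbrakk> \<Longrightarrow> tensor_eq A B N (xs @ ys) (xs' @ ys')"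
| tensor_commute: "tensor_eq A B N (xs @ ys) (ys @ xs)"
| tensor_add_left:
    "\<lbrakk>a \<in> carrier A; a' \<in> carrier A; n \<in> carrier N\<rbrakk>
      \<Longrightarrow> tensor_eq A B N [(a \<oplus>\<^bsub>A\<^esub> a', n)] [(a, n), (a', n)]"
| tensor_add_right:
    "\<lbrakk>a \<in> carrier A; n \<in> carrier N; n' \<in> carrier N\<rbrakk>
      \<Longrightarrow> tensor_eq A B N [(a, n \<oplus>\<^bsub>N\<^esub> n')] [(a, n), (a, n')]"
| tensor_zero: "n \<in> carrier N \<Longrightarrow> tensor_eq A B N [(\<zero>\<^bsub>A\<^esub>, n)] []"
| tensor_balanced:
    "\<lbrakk>a \<in> carrier A; b \<in> carrier B; n \<in> carrier N\<rbrakk>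
      \<Longrightarrow> tensor_eq A B N [(a \<otimes>\<^bsub>A\<^esub> b, n)] [(a, act N b n)]"

text \<open>An element of the tensor product, i.e. a class of \<open>tensor_eq\<close>, is represented in the
  universe by a chosen member of that class.\<close>

definition tensor_class ::
    "('k, 'a) module \<Rightarrow> ('k, 'a) module \<Rightarrow> ('k, 'a, 'x) umod \<Rightarrow> ('a \<times> ('a, 'x) univ) list
      \<Rightarrow> ('a, 'x) univ" where
  "tensor_class A B N xs = FSum (SOME ys. tensor_eq A B N xs ys)"

definition tensor :: "('k, 'a) module \<Rightarrow> ('k, 'a) module \<Rightarrow> ('k, 'a, 'x) umod \<Rightarrow> ('k, 'a, 'x) umod" where
  "tensor A B N =
     \<lparr>carrier = tensor_class A B N ` lists (carrier A \<times> carrier N),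
      mult = undefined, one = undefined,
      zero = tensor_class A B N [],
      add = (\<lambda>t u. tensor_class A B N (terms_of t @ terms_of u)),
      smult = (\<lambda>k t. tensor_class A B N (map (\<lambda>(a, n). (k \<odot>\<^bsub>A\<^esub> a, n)) (terms_of t))),
      act = (\<lambda>c t. tensor_class A B N (map (\<lambda>(a, n). (c \<otimes>\<^bsub>A\<^esub> a, n)) (terms_of t)))\<rparr>"

definition tensor_functor ::
    "('k, 'a) module \<Rightarrow> 'a \<Rightarrow>
      (('k, 'a, 'x) umod, ('a, 'x) univ \<Rightarrow> ('a, 'x) univ,
       ('k, 'a, 'x) umod, ('a, 'x) univ \<Rightarrow> ('a, 'x) univ) ftor" where
  "tensor_functor A e = (let B = corner A e in
     \<lparr>on_obj = tensor A B,
      on_arr = (\<lambda>N N' g. \<lambda>t\<in>carrier (tensor A B N).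
                  tensor_class A B N' (map (\<lambda>(a, n). (a, g n)) (terms_of t)))\<rparr>)"

end

theory Submission
  imports Defs
begin

text \<open>
  Under \<open>Hom\<^sub>A(Ae, M) = eM\<close> the functor is right adjoint to \<open>A \<otimes>\<^bsub>eAe\<^esub> -\<close>.  For every \<open>N\<close> the
  map \<open>a \<otimes> n \<mapsto> (e a e) n\<close> identifies \<open>e (A \<otimes> N) = e \<otimes> N\<close> with \<open>N\<close>, which inverts the unit.
  The counit \<open>A \<otimes> eM \<rightarrow> M\<close> has image \<open>AeM\<close>, which is \<open>M\<close> because \<open>e\<close> kills \<open>M/AeM\<close>.  On
  \<open>e (A \<otimes> eM) = e \<otimes> eM\<close> the counit is injective, so \<open>e\<close> kills its kernel; as \<open>A \<otimes> eM\<close> is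
  generated by its \<open>e\<close>-part, it lies in \<open>M(A)\<^sub>e\<close> by left speciality, and the kernel vanishes.
\<close>

section \<open>Modules over non-unital algebras\<close>

text \<open>An equivalence asks only for two natural isomorphisms, so no adjunction is set up, and
  the unit enters through its inverse \<open>hom_tensor_iso\<close>. As \<open>A\<close> need not
  have a unit, there may be no element 1 \<otimes> n; its place is taken by e \<otimes> n, and
  \<open>N\<close> being unital over eAe lets e move across the tensor sign. The definition of
  M(A)_e speaks of all subquotients, which are hard to survey for a tensor product; generation by
  the e-part is easy to check there, and left speciality turns it into membership. The other
  obstacle is the encoding: an element of A \<otimes> N is one chosen list out of its class, and an
  element of Hom is a function wrapped by \<open>Fn\<close>. Computations pass to arbitrary lists by
  \<open>tensor_class_eq_iff\<close> and to elements of eM by \<open>hom_cases\<close>.\<close>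

lemma amod_homI:
  assumes "f \<in> carrier M \<rightarrow>\<^sub>E carrier N"
    and "\<And>x y. \<lbrakk>x \<in> carrier M; y \<in> carrier M\<rbrakk> \<Longrightarrow> f (x \<oplus>\<^bsub>M\<^esub> y) = f x \<oplus>\<^bsub>N\<^esub> f y"
    and "\<And>k x. \<lbrakk>k \<in> carrier K; x \<in> carrier M\<rbrakk> \<Longrightarrow> f (k \<odot>\<^bsub>M\<^esub> x) = k \<odot>\<^bsub>N\<^esub> f x"
    and "\<And>a x. \<lbrakk>a \<in> carrier A; x \<in> carrier M\<rbrakk> \<Longrightarrow> f (act M a x) = act N a (f x)"
  shows "f \<in> amod_hom K A M N"
  using assms by (simp add: amod_hom_def)

lemma amod_homD:
  assumes "f \<in> amod_hom K A M N"
  shows amod_hom_PiE: "f \<in> carrier M \<rightarrow>\<^sub>E carrier N"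
    and amod_hom_closed: "x \<in> carrier M \<Longrightarrow> f x \<in> carrier N"
    and amod_hom_add: "\<lbrakk>x \<in> carrier M; y \<in> carrier M\<rbrakk> \<Longrightarrow> f (x \<oplus>\<^bsub>M\<^esub> y) = f x \<oplus>\<^bsub>N\<^esub> f y"
    and amod_hom_smult: "\<lbrakk>k \<in> carrier K; x \<in> carrier M\<rbrakk> \<Longrightarrow> f (k \<odot>\<^bsub>M\<^esub> x) = k \<odot>\<^bsub>N\<^esub> f x"
    and amod_hom_act: "\<lbrakk>a \<in> carrier A; x \<in> carrier M\<rbrakk> \<Longrightarrow> f (act M a x) = act N a (f x)"
  using assms by (auto simp: amod_hom_def PiE_iff)

text \<open>Cancellation in f 0 + f 0 = f 0. Additivity alone is assumed, because this is also
  applied to maps that are additive in one variable with the other held fixed, such as a \<mapsto> f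
  (a, n).\<close>

lemma additive_zero:
  assumes "abelian_group M" "abelian_group N"
    and closed: "\<And>x. x \<in> carrier M \<Longrightarrow> f x \<in> carrier N"
    and add: "\<And>x y. \<lbrakk>x \<in> carrier M; y \<in> carrier M\<rbrakk> \<Longrightarrow> f (x \<oplus>\<^bsub>M\<^esub> y) = f x \<oplus>\<^bsub>N\<^esub> f y"
  shows "f \<zero>\<^bsub>M\<^esub> = \<zero>\<^bsub>N\<^esub>"
proof -
  interpret M: abelian_group M by fact
  interpret N: abelian_group N by fact
  have "f \<zero>\<^bsub>M\<^esub> \<oplus>\<^bsub>N\<^esub> f \<zero>\<^bsub>M\<^esub> = f \<zero>\<^bsub>M\<^esub>"
    using add[of "\<zero>\<^bsub>M\<^esub>" "\<zero>\<^bsub>M\<^esub>"] by simp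
  then show ?thesis
    using closed[of "\<zero>\<^bsub>M\<^esub>"] N.add.r_cancel_one by auto
qed

lemma left_module_abelian_group: "left_module K A M \<Longrightarrow> abelian_group M"
  by (simp add: left_module_def module_def)

lemma left_moduleI:
  assumes "cring K" "abelian_group M"
    and "\<And>k x. \<lbrakk>k \<in> carrier K; x \<in> carrier M\<rbrakk> \<Longrightarrow> k \<odot>\<^bsub>M\<^esub> x \<in> carrier M"
    and "\<And>k l x. \<lbrakk>k \<in> carrier K; l \<in> carrier K; x \<in> carrier M\<rbrakk>
      \<Longrightarrow> (k \<oplus>\<^bsub>K\<^esub> l) \<odot>\<^bsub>M\<^esub> x = k \<odot>\<^bsub>M\<^esub> x \<oplus>\<^bsub>M\<^esub> l \<odot>\<^bsub>M\<^esub> x"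
    and "\<And>k x y. \<lbrakk>k \<in> carrier K; x \<in> carrier M; y \<in> carrier M\<rbrakk>
      \<Longrightarrow> k \<odot>\<^bsub>M\<^esub> (x \<oplus>\<^bsub>M\<^esub> y) = k \<odot>\<^bsub>M\<^esub> x \<oplus>\<^bsub>M\<^esub> k \<odot>\<^bsub>M\<^esub> y"
    and "\<And>k l x. \<lbrakk>k \<in> carrier K; l \<in> carrier K; x \<in> carrier M\<rbrakk>
      \<Longrightarrow> (k \<otimes>\<^bsub>K\<^esub> l) \<odot>\<^bsub>M\<^esub> x = k \<odot>\<^bsub>M\<^esub> (l \<odot>\<^bsub>M\<^esub> x)"
    and "\<And>x. x \<in> carrier M \<Longrightarrow> \<one>\<^bsub>K\<^esub> \<odot>\<^bsub>M\<^esub> x = x"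
    and "\<And>a x. \<lbrakk>a \<in> carrier A; x \<in> carrier M\<rbrakk> \<Longrightarrow> act M a x \<in> carrier M"
    and "\<And>a b x. \<lbrakk>a \<in> carrier A; b \<in> carrier A; x \<in> carrier M\<rbrakk>
      \<Longrightarrow> act M (a \<oplus>\<^bsub>A\<^esub> b) x = act M a x \<oplus>\<^bsub>M\<^esub> act M b x"
    and "\<And>a x y. \<lbrakk>a \<in> carrier A; x \<in> carrier M; y \<in> carrier M\<rbrakk>
      \<Longrightarrow> act M a (x \<oplus>\<^bsub>M\<^esub> y) = act M a x \<oplus>\<^bsub>M\<^esub> act M a y"
    and "\<And>a b x. \<lbrakk>a \<in> carrier A; b \<in> carrier A; x \<in> carrier M\<rbrakk>
      \<Longrightarrow> act M (a \<otimes>\<^bsub>A\<^esub> b) x = act M a (act M b x)"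
    and "\<And>k a x. \<lbrakk>k \<in> carrier K; a \<in> carrier A; x \<in> carrier M\<rbrakk>
      \<Longrightarrow> act M (k \<odot>\<^bsub>A\<^esub> a) x = k \<odot>\<^bsub>M\<^esub> act M a x"
    and "\<And>k a x. \<lbrakk>k \<in> carrier K; a \<in> carrier A; x \<in> carrier M\<rbrakk>
      \<Longrightarrow> act M a (k \<odot>\<^bsub>M\<^esub> x) = k \<odot>\<^bsub>M\<^esub> act M a x"
  shows "left_module K A M"
  using assms by (intro left_module.intro moduleI left_module_axioms.intro)

lemma amod_hom_zero:
  assumes "left_module K A M" "left_module K A N" "f \<in> amod_hom K A M N"
  shows "f \<zero>\<^bsub>M\<^esub> = \<zero>\<^bsub>N\<^esub>"
  using assms by (intro additive_zero) (auto simp: left_module_abelian_group amod_homD)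

lemma (in left_module) act_zero: "a \<in> carrier A \<Longrightarrow> act M a \<zero>\<^bsub>M\<^esub> = \<zero>\<^bsub>M\<^esub>"
  using left_module_axioms
  by (intro additive_zero[where f = "act M a"]) (auto simp: left_module_abelian_group act_closed act_add_right)

lemma (in left_module) amod_hom_identity: "(\<lambda>x\<in>carrier M. x) \<in> amod_hom K A M M"
  by (rule amod_homI) (auto simp: act_closed)

lemma amod_hom_compose:
  assumes "left_module K A M" "f \<in> amod_hom K A M N" "g \<in> amod_hom K A N P"
  shows "compose (carrier M) g f \<in> amod_hom K A M P"
proof -
  interpret M: left_module K A M by fact
  show ?thesis
    using assms(2,3)
    by (intro amod_homI) (auto simp: compose_def amod_homD M.act_closed)
qed

lemma is_category_full_module_category:
  assumes "\<And>M. M \<in> Ms \<Longrightarrow> left_module K A M"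
  shows "is_category (full_module_category K A Ms)"
proof
  fix X Y Z f g
  let ?C = "full_module_category K A Ms"
  show "Cmp ?C X Y Z g f \<in> Arr ?C X Z"
    if "X \<in> Obj ?C" "f \<in> Arr ?C X Y" "g \<in> Arr ?C Y Z"
    using that amod_hom_compose[OF assms] by (simp add: full_module_category_def)
  \<comment> \<open>Composing with a restricted identity gives back \<open>f\<close> itself because
    arrows are extensional: outside the carrier both sides are \<open>undefined\<close>.\<close>
  show "Cmp ?C X Y Y (Idn ?C Y) f = f" "Cmp ?C X X Y f (Idn ?C X) = f"
    if "f \<in> Arr ?C X Y"
    using that amod_hom_PiE[of f K A X Y]
    by (auto simp: full_module_category_def compose_def fun_eq_iff PiE_iff extensional_def)
  fix W h
  show "Cmp ?C W Y Z h (Cmp ?C W X Y g f) = Cmp ?C W X Z (Cmp ?C X Y Z h g) f"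
    if "f \<in> Arr ?C W X"
    using that by (auto simp: full_module_category_def compose_def amod_homD fun_eq_iff)
qed (use assms in \<open>auto simp: full_module_category_def left_module.amod_hom_identity\<close>)

text \<open>The class of objects \<open>Ms\<close> is arbitrary, as arrows and composition do not
  depend on it; the lemma thus serves M(A)_e and M(eAe) alike.\<close>

lemma isomorphism_full_module_category:
  assumes "left_module K A M" "left_module K A N" "f \<in> amod_hom K A M N"
    and bij: "bij_betw f (carrier M) (carrier N)"
  shows "isomorphism (full_module_category K A Ms) M N f"
proof -
  interpret M: left_module K A M by fact
  interpret N: left_module K A N by fact
  define g where "g = (\<lambda>y\<in>carrier N. inv_into (carrier M) f y)"
  have g_closed: "g y \<in> carrier M" and fg: "f (g y) = y" if "y \<in> carrier N" for y
    using that bij by (auto simp: g_def bij_betw_def inv_into_into f_inv_into_f)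
  have gf: "g (f x) = x" if "x \<in> carrier M" for x
    using that bij assms(3) by (simp add: g_def bij_betw_def amod_homD)
  \<comment> \<open>Source of the linearity of the inverse: by uniqueness of preimages, each law for
    \<open>g\<close> reduces to evaluating \<open>f\<close> on its right-hand side.\<close>
  have g_eq: "g y = x" if "x \<in> carrier M" "f x = y" for x y
    using gf that by blast
  have "g \<in> amod_hom K A N M"
  proof (rule amod_homI)
    show "g \<in> carrier N \<rightarrow>\<^sub>E carrier M"
      using g_closed by (auto simp: g_def)
  qed (rule g_eq; simp add: g_closed fg amod_homD[OF assms(3)] M.act_closed)+
  then show ?thesis
    using assms(3) gf fg
    by (auto simp: isomorphism_def full_module_category_def compose_def cong: restrict_cong intro!: bexI[of _ g])
qed

subsection \<open>Submodules and subquotients\<close>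

context left_module
begin

lemma asubmoduleI:
  assumes "H \<subseteq> carrier M" "\<zero>\<^bsub>M\<^esub> \<in> H"
    and "\<And>x y. \<lbrakk>x \<in> H; y \<in> H\<rbrakk> \<Longrightarrow> x \<oplus>\<^bsub>M\<^esub> y \<in> H"
    and "\<And>k x. \<lbrakk>k \<in> carrier K; x \<in> H\<rbrakk> \<Longrightarrow> k \<odot>\<^bsub>M\<^esub> x \<in> H"
    and "\<And>a x. \<lbrakk>a \<in> carrier A; x \<in> H\<rbrakk> \<Longrightarrow> act M a x \<in> H"
  shows "asubmodule K A H M"
proof -
  \<comment> \<open>Negatives come from the scalar -1 in \<open>K\<close>, which has a unit even
    where \<open>A\<close> has none.\<close>
  have "\<ominus>\<^bsub>M\<^esub> x \<in> H" if "x \<in> H" for x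
  proof -
    have "(\<ominus>\<^bsub>K\<^esub> \<one>\<^bsub>K\<^esub>) \<odot>\<^bsub>M\<^esub> x = \<ominus>\<^bsub>M\<^esub> x"
      using assms(1) that by (simp add: smult_l_minus subset_iff)
    then show ?thesis
      using assms(4)[OF _ that, of "\<ominus>\<^bsub>K\<^esub> \<one>\<^bsub>K\<^esub>"] by simp
  qed
  then show ?thesis
    using assms by (auto simp: asubmodule_def intro!: submoduleI)
qed

lemma asubmoduleD:
  assumes "asubmodule K A H M"
  shows asubmodule_subset: "H \<subseteq> carrier M"
    and asubmodule_zero: "\<zero>\<^bsub>M\<^esub> \<in> H"
    and asubmodule_add: "\<lbrakk>x \<in> H; y \<in> H\<rbrakk> \<Longrightarrow> x \<oplus>\<^bsub>M\<^esub> y \<in> H"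
    and asubmodule_smult: "\<lbrakk>k \<in> carrier K; x \<in> H\<rbrakk> \<Longrightarrow> k \<odot>\<^bsub>M\<^esub> x \<in> H"
    and asubmodule_act: "\<lbrakk>a \<in> carrier A; x \<in> H\<rbrakk> \<Longrightarrow> act M a x \<in> H"
proof -
  have H: "submodule H K M"
    using assms by (simp add: asubmodule_def)
  interpret H: submodule H K M by (rule H)
  show "H \<subseteq> carrier M" "\<zero>\<^bsub>M\<^esub> \<in> H"
    using H.subset H.one_closed by auto
  show "\<lbrakk>x \<in> H; y \<in> H\<rbrakk> \<Longrightarrow> x \<oplus>\<^bsub>M\<^esub> y \<in> H"
    "\<lbrakk>k \<in> carrier K; x \<in> H\<rbrakk> \<Longrightarrow> k \<odot>\<^bsub>M\<^esub> x \<in> H"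
    using submoduleE[OF H] by auto
  show "\<lbrakk>a \<in> carrier A; x \<in> H\<rbrakk> \<Longrightarrow> act M a x \<in> H"
    using assms by (simp add: asubmodule_def)
qed

lemma asubmodule_carrier: "asubmodule K A (carrier M) M"
  by (rule asubmoduleI) (auto simp: act_closed)

lemma asubmodule_trivial: "asubmodule K A {\<zero>\<^bsub>M\<^esub>} M"
  by (rule asubmoduleI) (auto simp: act_zero)

lemma asubmodule_AeM:
  assumes "e \<in> carrier A"
  shows "asubmodule K A (AeM K A e M) M"
proof -
  \<comment> \<open>The carrier itself lies in the intersected family; this is what keeps the
    intersection inside \<open>M\<close>.\<close>
  have *: "asubmodule K A (carrier M) M \<and> act M e ` carrier M \<subseteq> carrier M"
    using assms asubmodule_carrier act_closed by auto
  then have "AeM K A e M \<subseteq> carrier M"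
    unfolding AeM_def by blast
  then show ?thesis
    by (rule asubmoduleI) (auto simp: AeM_def asubmoduleD)
qed

lemma act_in_AeM: "m \<in> carrier M \<Longrightarrow> act M e m \<in> AeM K A e M"
  by (auto simp: AeM_def)

lemma AeM_subset: "\<lbrakk>asubmodule K A H M; act M e ` carrier M \<subseteq> H\<rbrakk> \<Longrightarrow> AeM K A e M \<subseteq> H"
  by (auto simp: AeM_def)

lemma coset_eq:
  assumes "asubmodule K A L M" "y \<in> L"
  shows "L +>\<^bsub>M\<^esub> y = L"
proof -
  interpret L: submodule L K M using assms(1) by (simp add: asubmodule_def)
  show ?thesis
    unfolding a_r_coset_def
    using add.coset_join2[of y L] assms L.subset L.subgroup_axioms by auto
qed

lemma asubmodule_kernel:
  assumes "left_module K A N" "f \<in> amod_hom K A M N"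
  shows "asubmodule K A {x \<in> carrier M. f x = \<zero>\<^bsub>N\<^esub>} M"
proof -
  interpret N: left_module K A N by fact
  show ?thesis
    using amod_hom_zero[OF left_module_axioms assms]
    by (intro asubmoduleI) (auto simp: amod_homD[OF assms(2)] act_closed N.act_zero)
qed

lemma asubmodule_image:
  assumes "left_module K A N" "f \<in> amod_hom K A M N"
  shows "asubmodule K A (f ` carrier M) N"
proof -
  interpret N: left_module K A N by fact
  have "\<zero>\<^bsub>N\<^esub> = f \<zero>\<^bsub>M\<^esub>"
    using amod_hom_zero[OF left_module_axioms assms] by simp
  then show ?thesis
    by (intro N.asubmoduleI)
      (auto simp: amod_homD[OF assms(2)] act_closed
        simp flip: amod_homD(3-5)[OF assms(2)])
qed

lemma amod_hom_inj_on:
  assumes "left_module K A N" "f \<in> amod_hom K A M N"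
    and ker: "\<And>x. \<lbrakk>x \<in> carrier M; f x = \<zero>\<^bsub>N\<^esub>\<rbrakk> \<Longrightarrow> x = \<zero>\<^bsub>M\<^esub>"
  shows "inj_on f (carrier M)"
proof (rule inj_onI)
  interpret N: left_module K A N by fact
  fix x y assume xy: "x \<in> carrier M" "y \<in> carrier M" "f x = f y"
  have "f (x \<oplus>\<^bsub>M\<^esub> \<ominus>\<^bsub>M\<^esub> y) = f (y \<oplus>\<^bsub>M\<^esub> \<ominus>\<^bsub>M\<^esub> y)"
    using xy by (simp add: amod_homD[OF assms(2)])
  also have "\<dots> = \<zero>\<^bsub>N\<^esub>"
    using xy amod_hom_zero[OF left_module_axioms assms(1,2)] by (simp add: r_neg)
  finally have "x \<oplus>\<^bsub>M\<^esub> \<ominus>\<^bsub>M\<^esub> y = \<zero>\<^bsub>M\<^esub>"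
    using xy by (intro ker) auto
  then show "x = y"
    using xy by (metis add.inv_closed minus_equality minus_minus)
qed

end

lemma subquotient_carrier:
  "carrier (subquotient M H L) = (\<lambda>h. L +>\<^bsub>M\<^esub> h) ` H"
  by (auto simp: subquotient_def A_RCOSETS_defs a_r_coset_defs)

section \<open>Membership in M(A)_e compared with generation by the e-part\<close>

lemma Mod_eD:
  assumes "M \<in> Obj (Mod_e K A e)"
  shows "nondegenerate_module K A M" "left_module K A M"
    and "\<lbrakk>asubmodule K A H M; asubmodule K A L M; L \<subset> H\<rbrakk>
      \<Longrightarrow> \<exists>q\<in>carrier (subquotient M H L). act (subquotient M H L) e q \<noteq> \<zero>\<^bsub>subquotient M H L\<^esub>"
  using assms
  by (auto simp: Mod_e_def full_module_category_def nondegenerate_module_def Let_def)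

text \<open>If \<open>e H \<subseteq> L\<close> then \<open>e\<close> annihilates \<open>H/L\<close>.\<close>

lemma Mod_e_eqI:
  assumes M: "M \<in> Obj (Mod_e K A e)"
    and H: "asubmodule K A H M" and L: "asubmodule K A L M" and "L \<subseteq> H"
    and e: "\<And>h. h \<in> H \<Longrightarrow> act M e h \<in> L"
  shows "H = L"
proof (rule ccontr)
  interpret M: left_module K A M using Mod_eD[OF M] by simp
  assume "H \<noteq> L"
  then obtain q where q: "q \<in> carrier (subquotient M H L)"
      "act (subquotient M H L) e q \<noteq> \<zero>\<^bsub>subquotient M H L\<^esub>"
    using Mod_eD(3)[OF M H L] \<open>L \<subseteq> H\<close> by blast
  then obtain h where h: "h \<in> H" "q = L +>\<^bsub>M\<^esub> h"
    by (auto simp: subquotient_carrier)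
  \<comment> \<open>The action on H/L is a union over all representatives of the coset. Every
    representative must lie in \<open>H\<close>, where e maps into \<open>L\<close>, and there must
    be at least one, as an empty union would not be \<open>L\<close>.\<close>
  have "q \<subseteq> H"
    using h \<open>L \<subseteq> H\<close> M.asubmodule_add[OF H] by (auto simp: a_r_coset_defs)
  moreover have "q \<noteq> {}"
    using h M.asubmodule_zero[OF L] by (auto simp: a_r_coset_defs)
  ultimately have "(\<Union>x\<in>q. L +>\<^bsub>M\<^esub> act M e x) = L"
    using M.coset_eq[OF L] e by blast
  then show False
    using q(2) by (simp add: subquotient_def)
qed

lemma Mod_e_eq_AeM:
  assumes "M \<in> Obj (Mod_e K A e)" "e \<in> carrier A"
  shows "carrier M = AeM K A e M"
proof -
  interpret M: left_module K A M using Mod_eD[OF assms(1)] by simp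
  show ?thesis
    using assms M.asubmodule_AeM M.act_in_AeM M.asubmodule_carrier M.asubmodule_subset
    by (intro Mod_e_eqI) auto
qed

text \<open>By left speciality H/L is again generated by its e-part. If e annihilated H/L, that
  e-part would be zero and generate only zero, contradicting L \<subset> H.\<close>

lemma Mod_e_if_left_special:
  fixes M :: "('k, 'a, 'x) umod"
  assumes "left_special TYPE('x) K A e" "generated_module K A e M" "e \<in> carrier A"
  shows "M \<in> Obj (Mod_e K A e)"
proof -
  have "\<exists>q\<in>carrier (subquotient M H L). act (subquotient M H L) e q \<noteq> \<zero>\<^bsub>subquotient M H L\<^esub>"
    if H: "asubmodule K A H M" and L: "asubmodule K A L M" and "L \<subset> H" for H L
  proof (rule ccontr)
    let ?Q = "subquotient M H L"
    assume "\<not> ?thesis"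
    then have zero: "act ?Q e ` carrier ?Q \<subseteq> {\<zero>\<^bsub>?Q\<^esub>}"
      by blast
    interpret M: left_module K A M
      using assms(2) by (simp add: generated_module_def nondegenerate_module_def)
    have Q: "generated_module K A e ?Q"
      using assms that unfolding left_special_def by blast
    then interpret Q: left_module K A ?Q
      by (simp add: generated_module_def nondegenerate_module_def)
    have "carrier ?Q \<subseteq> {\<zero>\<^bsub>?Q\<^esub>}"
      using Q Q.AeM_subset[OF Q.asubmodule_trivial zero] by (simp add: generated_module_def)
    then have eq: "L +>\<^bsub>M\<^esub> h = L" if "h \<in> H" for h
      using that by (auto simp: subquotient_carrier) (auto simp: subquotient_def)
    obtain h where h: "h \<in> H" "h \<notin> L"
      using \<open>L \<subset> H\<close> by blast
    moreover have "h \<in> L +>\<^bsub>M\<^esub> h"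
      using h M.asubmodule_zero[OF L] M.asubmodule_subset[OF H]
      by (force simp: a_r_coset_defs)
    ultimately show False
      using eq by blast
  qed
  then show ?thesis
    using assms(2) by (simp add: Mod_e_def full_module_category_def generated_module_def Let_def)
qed

section \<open>Tensor products over a corner\<close>

text \<open>Well-definedness of whatever is done termwise to formal sums, with hypotheses matched to
  the generators of \<open>tensor_eq\<close>. With \<open>g\<close> the identity it covers scalars
  and the action of \<open>A\<close> on left factors, with \<open>p\<close> the identity the tensor
  functor on arrows.\<close>

lemma tensor_eq_map:
  assumes "tensor_eq A B N xs ys"
    and "\<And>a. a \<in> carrier A \<Longrightarrow> p a \<in> carrier A"
    and "\<And>a a'. \<lbrakk>a \<in> carrier A; a' \<in> carrier A\<rbrakk> \<Longrightarrow> p (a \<oplus>\<^bsub>A\<^esub> a') = p a \<oplus>\<^bsub>A\<^esub> p a'"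
    and "p \<zero>\<^bsub>A\<^esub> = \<zero>\<^bsub>A\<^esub>"
    and "\<And>a b. \<lbrakk>a \<in> carrier A; b \<in> carrier B\<rbrakk> \<Longrightarrow> p (a \<otimes>\<^bsub>A\<^esub> b) = p a \<otimes>\<^bsub>A\<^esub> b"
    and "\<And>n. n \<in> carrier N \<Longrightarrow> g n \<in> carrier N'"
    and "\<And>n n'. \<lbrakk>n \<in> carrier N; n' \<in> carrier N\<rbrakk> \<Longrightarrow> g (n \<oplus>\<^bsub>N\<^esub> n') = g n \<oplus>\<^bsub>N'\<^esub> g n'"
    and "\<And>b n. \<lbrakk>b \<in> carrier B; n \<in> carrier N\<rbrakk> \<Longrightarrow> g (act N b n) = act N' b (g n)"
  shows "tensor_eq A B N' (map (\<lambda>(a, n). (p a, g n)) xs) (map (\<lambda>(a, n). (p a, g n)) ys)"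
  using assms(1)
proof induction
  case (tensor_sym xs ys)
  from tensor_sym.IH show ?case by (rule tensor_eq.tensor_sym)
next
  case (tensor_trans xs ys zs)
  from tensor_trans.IH show ?case by (rule tensor_eq.tensor_trans)
qed (simp_all add: assms tensor_eq.intros(1,4-))

text \<open>Equivalent lists define the same predicate, and \<open>SOME\<close> depends on the
  predicate only, so they receive the same representative. Conversely, the chosen list is equivalent
  to the one it was chosen for.\<close>

lemma tensor_class_eq_iff:
  "tensor_class A B N xs = tensor_class A B N ys \<longleftrightarrow> tensor_eq A B N xs ys"
proof
  have some: "tensor_eq A B N xs (SOME zs. tensor_eq A B N xs zs)" for xs
    by (rule someI) (rule tensor_refl)
  show "tensor_eq A B N xs ys" if "tensor_class A B N xs = tensor_class A B N ys"
    using some[of xs] some[of ys] that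
    by (auto simp: tensor_class_def intro: tensor_eq.tensor_trans tensor_eq.tensor_sym)
next
  assume "tensor_eq A B N xs ys"
  then have "tensor_eq A B N xs = tensor_eq A B N ys"
    by (auto simp: fun_eq_iff intro: tensor_eq.tensor_trans tensor_eq.tensor_sym)
  then show "tensor_class A B N xs = tensor_class A B N ys"
    by (simp add: tensor_class_def)
qed

text \<open>The operations of \<open>tensor\<close> work on the stored list, which need not be the
  one at hand; this equivalence allows replacing it.\<close>

lemma tensor_eq_terms_of: "tensor_eq A B N xs (terms_of (tensor_class A B N xs))"
  unfolding tensor_class_def terms_of.simps by (rule someI) (rule tensor_refl)

text \<open>A sum over a list and not over a set, since a term may be repeated in a formal
  sum.\<close>

definition list_add :: "('m, 'c) ring_scheme \<Rightarrow> ('p \<Rightarrow> 'm) \<Rightarrow> 'p list \<Rightarrow> 'm" where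
  "list_add M f xs = foldr (\<lambda>p s. f p \<oplus>\<^bsub>M\<^esub> s) xs \<zero>\<^bsub>M\<^esub>"

lemma list_add_simps [simp]:
  "list_add M f [] = \<zero>\<^bsub>M\<^esub>"
  "list_add M f (p # xs) = f p \<oplus>\<^bsub>M\<^esub> list_add M f xs"
  by (simp_all add: list_add_def)

lemma (in abelian_monoid) list_add_closed:
  "\<lbrakk>xs \<in> lists P; \<And>p. p \<in> P \<Longrightarrow> f p \<in> carrier G\<rbrakk> \<Longrightarrow> list_add G f xs \<in> carrier G"
  by (induction xs) auto

lemma (in abelian_monoid) list_add_append:
  "\<lbrakk>xs \<in> lists P; ys \<in> lists P; \<And>p. p \<in> P \<Longrightarrow> f p \<in> carrier G\<rbrakk>
    \<Longrightarrow> list_add G f (xs @ ys) = list_add G f xs \<oplus> list_add G f ys"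
  by (induction xs) (auto simp: a_assoc list_add_closed[where P = P])

text \<open>Linearity of lifts and naturality of both transformations come down to this passage from
  single terms to sums along an additive \<open>h\<close>.\<close>

lemma list_add_map:
  assumes "xs \<in> lists P" "\<And>p. p \<in> P \<Longrightarrow> f p \<in> carrier M"
    and "\<And>x. x \<in> carrier M \<Longrightarrow> h x \<in> carrier M'"
    and "\<And>x y. \<lbrakk>x \<in> carrier M; y \<in> carrier M\<rbrakk> \<Longrightarrow> h (x \<oplus>\<^bsub>M\<^esub> y) = h x \<oplus>\<^bsub>M'\<^esub> h y"
    and "\<And>p. p \<in> P \<Longrightarrow> f' (\<phi> p) = h (f p)"
    and "abelian_group M" "abelian_group M'"
  shows "list_add M' f' (map \<phi> xs) = h (list_add M f xs)"
  using assms(1)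
proof (induction xs)
  case Nil
  then show ?case using additive_zero[of M M' h] assms by simp
next
  case (Cons p xs)
  interpret M: abelian_group M by fact
  from Cons show ?case
    using assms(2-5) M.list_add_closed[where P = P] by auto
qed

text \<open>Evaluates \<open>f\<close> on the stored list, which makes it a function for every
  \<open>f\<close>; that other lists of the class give the same value is the content of
  \<open>tensor_lift_cls\<close>.\<close>

definition tensor_lift ::
    "('k, 'a, ('a, 'x) univ) amod \<Rightarrow> ('k, 'a, 'm) amod \<Rightarrow> ('a \<times> ('a, 'x) univ \<Rightarrow> 'm)
      \<Rightarrow> ('a, 'x) univ \<Rightarrow> 'm" where
  "tensor_lift T M f = (\<lambda>t\<in>carrier T. list_add M f (terms_of t))"

section \<open>The corner algebra eAe and common left units in A\<close>

locale idempotent_corner = idempotented_algebra K A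
  for K :: "'k ring" and A :: "('k, 'a) module" +
  fixes e :: 'a
  assumes idempotent: "idempotent_elem A e"
begin

abbreviation "B \<equiv> corner A e"

lemma e_closed [simp]: "e \<in> carrier A"
  and e_idem [simp]: "e \<otimes>\<^bsub>A\<^esub> e = e"
  using idempotent by (auto simp: idempotent_elem_def)

lemma corner_simps [simp]:
  "add B = add A" "mult B = mult A" "zero B = zero A" "one B = e" "smult B = smult A"
  by (simp_all add: corner_def)

text \<open>Replaces the parametrisation e a e by the equations e b = b = b e, from which closure of
  eAe under the operations can be read off.\<close>

lemma corner_carrier:
  "b \<in> carrier B \<longleftrightarrow> b \<in> carrier A \<and> e \<otimes>\<^bsub>A\<^esub> b = b \<and> b \<otimes>\<^bsub>A\<^esub> e = b"
proof
  assume "b \<in> carrier B"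
  then obtain a where a: "a \<in> carrier A" "b = e \<otimes>\<^bsub>A\<^esub> a \<otimes>\<^bsub>A\<^esub> e"
    by (auto simp: corner_def)
  have "e \<otimes>\<^bsub>A\<^esub> b = b"
    using a by (simp add: mult_closed flip: mult_assoc)
  moreover have "b \<otimes>\<^bsub>A\<^esub> e = b"
    using a by (simp add: mult_closed mult_assoc)
  ultimately show "b \<in> carrier A \<and> e \<otimes>\<^bsub>A\<^esub> b = b \<and> b \<otimes>\<^bsub>A\<^esub> e = b"
    using a by (simp add: mult_closed)
next
  assume "b \<in> carrier A \<and> e \<otimes>\<^bsub>A\<^esub> b = b \<and> b \<otimes>\<^bsub>A\<^esub> e = b"
  then show "b \<in> carrier B"
    by (auto simp: corner_def intro!: exI[of _ b])
qed

lemma corner_closed [simp]: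
  "b \<in> carrier B \<Longrightarrow> b \<in> carrier A"
  "e \<in> carrier B"
  "a \<in> carrier A \<Longrightarrow> e \<otimes>\<^bsub>A\<^esub> a \<otimes>\<^bsub>A\<^esub> e \<in> carrier B"
  by (simp_all add: corner_carrier) (auto simp: corner_def simp flip: corner_carrier)

lemma corner_ops_closed:
  "\<lbrakk>b \<in> carrier B; c \<in> carrier B\<rbrakk> \<Longrightarrow> b \<oplus>\<^bsub>A\<^esub> c \<in> carrier B"
  "\<lbrakk>b \<in> carrier B; c \<in> carrier B\<rbrakk> \<Longrightarrow> b \<otimes>\<^bsub>A\<^esub> c \<in> carrier B"
  "\<lbrakk>k \<in> carrier K; b \<in> carrier B\<rbrakk> \<Longrightarrow> k \<odot>\<^bsub>A\<^esub> b \<in> carrier B"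
proof -
  show "b \<otimes>\<^bsub>A\<^esub> c \<in> carrier B" if "b \<in> carrier B" "c \<in> carrier B"
    using that mult_assoc[of e b c] mult_assoc[of b c e] by (simp add: corner_carrier mult_closed)
qed (simp_all add: corner_carrier mult_add_left mult_add_right smult_mult_left smult_mult_right)

lemma abelian_group_A: "abelian_group A" ..

text \<open>An idempotent u dominating both the unit f of the smaller set and a local unit g of the
  new element fixes everything: u x = u (v x) = (u v) x = v x = x with v = f or v = g. It makes A
  \<otimes> N non-degenerate, where finitely many left factors have to be fixed at once.\<close>

lemma common_left_unit:
  "finite S \<Longrightarrow> S \<subseteq> carrier A \<Longrightarrow> \<exists>f. idempotent_elem A f \<and> (\<forall>a\<in>S. f \<otimes>\<^bsub>A\<^esub> a = a)"
proof (induction S rule: finite_induct)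
  case empty
  then show ?case using idempotent by auto
next
  case (insert a S)
  then obtain f where f: "idempotent_elem A f" "\<forall>a\<in>S. f \<otimes>\<^bsub>A\<^esub> a = a"
    by auto
  obtain g where g: "idempotent_elem A g" "g \<otimes>\<^bsub>A\<^esub> a = a"
    using local_unit insert.prems by auto
  obtain u where u: "idempotent_elem A u" "u \<otimes>\<^bsub>A\<^esub> f = f" "u \<otimes>\<^bsub>A\<^esub> g = g"
    using common_unit[OF f(1) g(1)] by auto
  have "u \<otimes>\<^bsub>A\<^esub> x = x" if "v \<otimes>\<^bsub>A\<^esub> x = x" "u \<otimes>\<^bsub>A\<^esub> v = v" "v \<in> carrier A" "x \<in> carrier A" for v x
    using that u(1) mult_assoc[of u v x] by (simp add: idempotent_elem_def)
  then show ?case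
    using u f g insert.prems by (intro exI[of _ u]) (auto simp: idempotent_elem_def)
qed

end

section \<open>The A-module structure on the tensor product\<close>

locale corner_module = idempotent_corner K A e + N: left_module K "corner A e" N
  for K :: "'k ring" and A :: "('k, 'a) module" and e :: 'a and N :: "('k, 'a, 'x) umod" +
  assumes act_e_N: "n \<in> carrier N \<Longrightarrow> act N e n = n"
begin

abbreviation "teq \<equiv> tensor_eq A B N"
abbreviation "cls \<equiv> tensor_class A B N"
abbreviation "T \<equiv> tensor A B N"

definition formal_sums :: "('a \<times> ('a, 'x) univ) list set" where
  "formal_sums = lists (carrier A \<times> carrier N)"

lemma formal_sums_simps [simp]:
  "[] \<in> formal_sums"
  "p # xs \<in> formal_sums \<longleftrightarrow> p \<in> carrier A \<times> carrier N \<and> xs \<in> formal_sums"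
  "xs @ ys \<in> formal_sums \<longleftrightarrow> xs \<in> formal_sums \<and> ys \<in> formal_sums"
  by (auto simp: formal_sums_def)

lemma formal_sums_map:
  "\<lbrakk>xs \<in> formal_sums; \<And>a. a \<in> carrier A \<Longrightarrow> p a \<in> carrier A\<rbrakk>
    \<Longrightarrow> map (\<lambda>(a, n). (p a, n)) xs \<in> formal_sums"
  by (induction xs) auto

text \<open>\<open>tensor_eq\<close> relates arbitrary lists, also ones with entries outside the
  carriers. The defining relations have legal terms on both sides, so a derivation starting from a
  formal sum passes through formal sums only.\<close>

lemma tensor_eq_formal_sums: "teq xs ys \<Longrightarrow> xs \<in> formal_sums \<longleftrightarrow> ys \<in> formal_sums"
  by (induction rule: tensor_eq.induct) (auto simp: mult_closed N.act_closed)

lemma cls_closed: "xs \<in> formal_sums \<Longrightarrow> cls xs \<in> carrier T"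
  by (simp add: tensor_def formal_sums_def)

lemma tensor_cases:
  assumes "t \<in> carrier T"
  obtains xs where "xs \<in> formal_sums" "t = cls xs"
  using assms by (auto simp: tensor_def formal_sums_def)

lemma cls_append_cong:
  "\<lbrakk>teq xs xs'; teq ys ys'\<rbrakk> \<Longrightarrow> cls (xs @ ys) = cls (xs' @ ys')"
  by (simp add: tensor_class_eq_iff tensor_append)

lemma tensor_zero_cls: "\<zero>\<^bsub>T\<^esub> = cls []"
  by (simp add: tensor_def)

lemma tensor_add_cls: "cls xs \<oplus>\<^bsub>T\<^esub> cls ys = cls (xs @ ys)"
  by (auto simp: tensor_def intro!: cls_append_cong intro: tensor_eq.tensor_sym tensor_eq_terms_of)

lemma cls_map_left_cong:
  assumes "teq xs ys"
    and "\<And>a. a \<in> carrier A \<Longrightarrow> p a \<in> carrier A"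
    and "\<And>a a'. \<lbrakk>a \<in> carrier A; a' \<in> carrier A\<rbrakk> \<Longrightarrow> p (a \<oplus>\<^bsub>A\<^esub> a') = p a \<oplus>\<^bsub>A\<^esub> p a'"
    and "\<And>a b. \<lbrakk>a \<in> carrier A; b \<in> carrier B\<rbrakk> \<Longrightarrow> p (a \<otimes>\<^bsub>A\<^esub> b) = p a \<otimes>\<^bsub>A\<^esub> b"
  shows "cls (map (\<lambda>(a, n). (p a, n)) xs) = cls (map (\<lambda>(a, n). (p a, n)) ys)"
proof -
  have "p \<zero>\<^bsub>A\<^esub> = \<zero>\<^bsub>A\<^esub>"
    using assms by (intro additive_zero) (auto simp: abelian_group_A)
  then show ?thesis
    unfolding tensor_class_eq_iff
    using assms by (intro tensor_eq_map) (auto simp: N.act_closed)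
qed

lemma tensor_smult_cls:
  "k \<in> carrier K \<Longrightarrow> k \<odot>\<^bsub>T\<^esub> cls xs = cls (map (\<lambda>(a, n). (k \<odot>\<^bsub>A\<^esub> a, n)) xs)"
  unfolding tensor_def module.simps
  by (rule cls_map_left_cong[OF tensor_eq.tensor_sym[OF tensor_eq_terms_of]])
    (auto simp: smult_r_distr smult_mult_left)

lemma tensor_act_cls:
  "c \<in> carrier A \<Longrightarrow> act T c (cls xs) = cls (map (\<lambda>(a, n). (c \<otimes>\<^bsub>A\<^esub> a, n)) xs)"
  unfolding tensor_def amod.simps
  by (rule cls_map_left_cong[OF tensor_eq.tensor_sym[OF tensor_eq_terms_of]])
    (auto simp: mult_closed mult_add_right mult_assoc)

lemma cls_map_closed:
  "\<lbrakk>xs \<in> formal_sums; \<And>a. a \<in> carrier A \<Longrightarrow> p a \<in> carrier A\<rbrakk>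
    \<Longrightarrow> cls (map (\<lambda>(a, n). (p a, n)) xs) \<in> carrier T"
  by (intro cls_closed formal_sums_map)

lemma cls_map_cong:
  "\<lbrakk>xs \<in> formal_sums; \<And>a. a \<in> carrier A \<Longrightarrow> p a = q a\<rbrakk>
    \<Longrightarrow> cls (map (\<lambda>(a, n). (p a, n)) xs) = cls (map (\<lambda>(a, n). (q a, n)) xs)"
  by (intro arg_cong[where f = cls] map_cong) (auto simp: formal_sums_def)

lemma tensor_abelian_monoid: "abelian_monoid T"
proof (rule abelian_monoidI)
  fix x y assume "x \<in> carrier T" "y \<in> carrier T"
  then show "x \<oplus>\<^bsub>T\<^esub> y \<in> carrier T" "x \<oplus>\<^bsub>T\<^esub> y = y \<oplus>\<^bsub>T\<^esub> x"
    by (auto elim!: tensor_cases simp: tensor_add_cls cls_closed tensor_class_eq_iff tensor_commute)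
qed (auto elim!: tensor_cases simp: tensor_add_cls tensor_zero_cls cls_closed)

lemma cls_Cons: "cls (p # xs) = cls [p] \<oplus>\<^bsub>T\<^esub> cls xs"
  by (simp add: tensor_add_cls)

lemma cls_add_left:
  "\<lbrakk>a \<in> carrier A; a' \<in> carrier A; n \<in> carrier N\<rbrakk>
    \<Longrightarrow> cls [(a \<oplus>\<^bsub>A\<^esub> a', n)] = cls [(a, n)] \<oplus>\<^bsub>T\<^esub> cls [(a', n)]"
  by (simp add: tensor_add_cls tensor_class_eq_iff tensor_add_left)

lemma cls_add_right:
  "\<lbrakk>a \<in> carrier A; n \<in> carrier N; n' \<in> carrier N\<rbrakk>
    \<Longrightarrow> cls [(a, n \<oplus>\<^bsub>N\<^esub> n')] = cls [(a, n)] \<oplus>\<^bsub>T\<^esub> cls [(a, n')]"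
  by (simp add: tensor_add_cls tensor_class_eq_iff tensor_add_right)

lemma cls_balanced:
  "\<lbrakk>a \<in> carrier A; b \<in> carrier B; n \<in> carrier N\<rbrakk> \<Longrightarrow> cls [(a \<otimes>\<^bsub>A\<^esub> b, n)] = cls [(a, act N b n)]"
  by (simp add: tensor_class_eq_iff tensor_balanced)

lemma cls_zero_left: "n \<in> carrier N \<Longrightarrow> cls [(\<zero>\<^bsub>A\<^esub>, n)] = \<zero>\<^bsub>T\<^esub>"
  by (simp add: tensor_zero_cls tensor_class_eq_iff tensor_zero)

lemma tensor_abelian_group: "abelian_group T"
proof -
  interpret T: abelian_monoid T by (rule tensor_abelian_monoid)
  \<comment> \<open>If s is inverse to the sum of \<open>xs\<close>, then s + (-a) \<otimes> n is
    inverse to that sum with a \<otimes> n added.\<close>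
  have inv: "\<exists>s\<in>carrier T. s \<oplus>\<^bsub>T\<^esub> cls xs = \<zero>\<^bsub>T\<^esub>" if "xs \<in> formal_sums" for xs
    using that
  proof (induction xs)
    case Nil
    then show ?case by (auto simp flip: tensor_zero_cls)
  next
    case (Cons p xs)
    then obtain s where s: "s \<in> carrier T" "s \<oplus>\<^bsub>T\<^esub> cls xs = \<zero>\<^bsub>T\<^esub>" by auto
    obtain a n where p: "p = (a, n)" "a \<in> carrier A" "n \<in> carrier N"
      using Cons.prems by auto
    have "cls [(\<ominus>\<^bsub>A\<^esub> a, n)] \<oplus>\<^bsub>T\<^esub> cls [p] = \<zero>\<^bsub>T\<^esub>"
      using p cls_add_left[of "\<ominus>\<^bsub>A\<^esub> a" a n] by (simp add: M.l_neg cls_zero_left)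
    moreover have "cls [(\<ominus>\<^bsub>A\<^esub> a, n)] \<in> carrier T" "cls [p] \<in> carrier T" "cls xs \<in> carrier T"
      using p Cons.prems by (auto intro!: cls_closed)
    ultimately have "(s \<oplus>\<^bsub>T\<^esub> cls [(\<ominus>\<^bsub>A\<^esub> a, n)]) \<oplus>\<^bsub>T\<^esub> cls (p # xs) = \<zero>\<^bsub>T\<^esub>"
      using s unfolding cls_Cons[of p xs] by (metis T.a_assoc T.add.m_closed T.l_zero)
    then show ?case
      using s \<open>cls [(\<ominus>\<^bsub>A\<^esub> a, n)] \<in> carrier T\<close> by blast
  qed
  show ?thesis
    by (rule abelian_groupI) (auto simp: T.a_assoc intro: T.a_comm cls_closed elim!: tensor_cases inv)
qed

lemma cls_zero_right:
  assumes "a \<in> carrier A"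
  shows "cls [(a, \<zero>\<^bsub>N\<^esub>)] = \<zero>\<^bsub>T\<^esub>"
  using assms
  by (intro additive_zero[where f = "\<lambda>n. cls [(a, n)]" and M = N])
    (auto simp: tensor_abelian_group N.abelian_group_axioms cls_add_right intro: cls_closed)

text \<open>Distributivity in the left variable, for scalars and for the action. The right-hand side
  has twice as many terms, so the termwise \<open>cls_map_cong\<close> does not apply; each term is
  split by \<open>cls_add_left\<close> and the sums are reordered.\<close>

lemma cls_map_add:
  assumes "xs \<in> formal_sums" "\<And>a. a \<in> carrier A \<Longrightarrow> p a \<in> carrier A" "\<And>a. a \<in> carrier A \<Longrightarrow> q a \<in> carrier A"
  shows "cls (map (\<lambda>(a, n). (p a \<oplus>\<^bsub>A\<^esub> q a, n)) xs) =
    cls (map (\<lambda>(a, n). (p a, n)) xs) \<oplus>\<^bsub>T\<^esub> cls (map (\<lambda>(a, n). (q a, n)) xs)"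
proof -
  interpret T: abelian_group T by (rule tensor_abelian_group)
  show ?thesis
    using assms(1)
  proof (induction xs)
    case Nil
    then show ?case by (simp flip: tensor_zero_cls)
  next
    case (Cons x xs)
    then obtain a n where x: "x = (a, n)" "a \<in> carrier A" "n \<in> carrier N" by auto
    let ?map = "\<lambda>p. map (\<lambda>(a, n). (p a, n)) xs"
    let ?pq = "\<lambda>a. p a \<oplus>\<^bsub>A\<^esub> q a"
    have closed: "cls (?map p) \<in> carrier T" "cls (?map q) \<in> carrier T"
      using Cons.prems assms by (simp_all add: cls_map_closed)
    have closed': "cls [(p a, n)] \<in> carrier T" "cls [(q a, n)] \<in> carrier T"
      using x assms by (simp_all add: cls_closed)
    have "cls (map (\<lambda>(a, n). (?pq a, n)) (x # xs)) =
        (cls [(p a, n)] \<oplus>\<^bsub>T\<^esub> cls [(q a, n)]) \<oplus>\<^bsub>T\<^esub> (cls (?map p) \<oplus>\<^bsub>T\<^esub> cls (?map q))"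
      using Cons x assms(2,3) cls_Cons[of "(?pq a, n)" "?map ?pq"] by (simp add: cls_add_left)
    also have "\<dots> = (cls [(p a, n)] \<oplus>\<^bsub>T\<^esub> cls (?map p)) \<oplus>\<^bsub>T\<^esub> (cls [(q a, n)] \<oplus>\<^bsub>T\<^esub> cls (?map q))"
      using closed closed' by (simp add: T.add.m_ac)
    finally show ?case
      using x cls_Cons[of "(p a, n)" "?map p"] cls_Cons[of "(q a, n)" "?map q"] by simp
  qed
qed

lemma tensor_left_module: "left_module K A T"
proof (rule left_moduleI)
  show "cring K" ..
  show "abelian_group T" by (rule tensor_abelian_group)
  fix x assume "x \<in> carrier T"
  then obtain xs where xs: "xs \<in> formal_sums" and x: "x = cls xs"
    by (rule tensor_cases)
  \<comment> \<open>The second version is for goals in which two maps have been merged into one and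
    pairs appear through \<open>fst\<close> and \<open>snd\<close>.\<close>
  note cong = cls_map_cong[OF xs] cls_map_cong[OF xs, unfolded case_prod_beta']
  note ops = x tensor_smult_cls tensor_act_cls mult_closed comp_def case_prod_beta'
  show "\<one>\<^bsub>K\<^esub> \<odot>\<^bsub>T\<^esub> x = x"
    using cong(1)[of "\<lambda>a. \<one>\<^bsub>K\<^esub> \<odot>\<^bsub>A\<^esub> a" "\<lambda>a. a"] x by (simp add: tensor_smult_cls)
  show "k \<odot>\<^bsub>T\<^esub> x \<in> carrier T" if "k \<in> carrier K" for k
    using that xs by (auto simp: x tensor_smult_cls intro!: cls_map_closed)
  show "act T a x \<in> carrier T" if "a \<in> carrier A" for a
    using that xs by (auto simp: x tensor_act_cls mult_closed intro!: cls_map_closed)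
  show "k \<odot>\<^bsub>T\<^esub> (x \<oplus>\<^bsub>T\<^esub> y) = k \<odot>\<^bsub>T\<^esub> x \<oplus>\<^bsub>T\<^esub> k \<odot>\<^bsub>T\<^esub> y" if "k \<in> carrier K" "y \<in> carrier T" for k y
    using that by (auto simp: x tensor_smult_cls tensor_add_cls elim!: tensor_cases)
  show "act T a (x \<oplus>\<^bsub>T\<^esub> y) = act T a x \<oplus>\<^bsub>T\<^esub> act T a y" if "a \<in> carrier A" "y \<in> carrier T" for a y
    using that by (auto simp: x tensor_act_cls tensor_add_cls elim!: tensor_cases)
  show "(k \<oplus>\<^bsub>K\<^esub> l) \<odot>\<^bsub>T\<^esub> x = k \<odot>\<^bsub>T\<^esub> x \<oplus>\<^bsub>T\<^esub> l \<odot>\<^bsub>T\<^esub> x" if "k \<in> carrier K" "l \<in> carrier K" for k l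
    using that xs by (simp add: x tensor_smult_cls flip: cls_map_add) (rule cong(1), simp add: smult_l_distr)
  show "act T (a \<oplus>\<^bsub>A\<^esub> b) x = act T a x \<oplus>\<^bsub>T\<^esub> act T b x" if "a \<in> carrier A" "b \<in> carrier A" for a b
    using that xs by (simp add: x tensor_act_cls mult_closed flip: cls_map_add) (rule cong(1), simp add: mult_add_left)
  show "(k \<otimes>\<^bsub>K\<^esub> l) \<odot>\<^bsub>T\<^esub> x = k \<odot>\<^bsub>T\<^esub> (l \<odot>\<^bsub>T\<^esub> x)" if "k \<in> carrier K" "l \<in> carrier K" for k l
    using that by (simp add: ops) (rule cong(2), simp add: smult_assoc1)
  show "act T (a \<otimes>\<^bsub>A\<^esub> b) x = act T a (act T b x)" if "a \<in> carrier A" "b \<in> carrier A" for a b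
    using that by (simp add: ops) (rule cong(2), simp add: mult_assoc)
  show "act T (k \<odot>\<^bsub>A\<^esub> a) x = k \<odot>\<^bsub>T\<^esub> act T a x" if "k \<in> carrier K" "a \<in> carrier A" for k a
    using that by (simp add: ops) (rule cong(2), simp add: smult_mult_left)
  show "act T a (k \<odot>\<^bsub>T\<^esub> x) = k \<odot>\<^bsub>T\<^esub> act T a x" if "k \<in> carrier K" "a \<in> carrier A" for k a
    using that by (simp add: ops) (rule cong(2), simp add: smult_mult_right)
qed

sublocale T: left_module K A T
  by (rule tensor_left_module)

lemma tensor_nondegenerate: "nondegenerate_module K A T"
  unfolding nondegenerate_module_def
proof (intro conjI ballI tensor_left_module)
  fix t assume "t \<in> carrier T"
  then obtain xs where xs: "xs \<in> formal_sums" "t = cls xs" by (rule tensor_cases)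
  have "fst ` set xs \<subseteq> carrier A"
    using xs(1) by (auto simp: formal_sums_def)
  then obtain f where f: "idempotent_elem A f" "\<forall>a\<in>fst ` set xs. f \<otimes>\<^bsub>A\<^esub> a = a"
    using common_left_unit[of "fst ` set xs"] by auto
  have "map (\<lambda>(a, n). (f \<otimes>\<^bsub>A\<^esub> a, n)) xs = map (\<lambda>x. x) xs"
    using f(2) by (intro map_cong) auto
  then show "\<exists>f. idempotent_elem A f \<and> act T f t = t"
    using f xs by (intro exI[of _ f]) (simp add: tensor_act_cls idempotent_elem_def)
qed

text \<open>a \<otimes> n = a \<otimes> e n = a e \<otimes> n, because \<open>N\<close> is unital.
  Every elementary tensor is therefore a multiple of an element of e (A \<otimes> N), which is why
  the e-part generates.\<close>

lemma cls_eq_act: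
  assumes "a \<in> carrier A" "n \<in> carrier N"
  shows "cls [(a, n)] = act T a (act T e (cls [(e, n)]))"
  using assms cls_balanced[of a e n] by (simp add: tensor_act_cls mult_closed act_e_N)

lemma tensor_generated: "generated_module K A e T"
proof -
  have "cls xs \<in> AeM K A e T" if "xs \<in> formal_sums" for xs
    using that
  proof (induction xs)
    case Nil
    then show ?case
      using T.asubmodule_zero[OF T.asubmodule_AeM] by (simp add: tensor_zero_cls)
  next
    case (Cons p xs)
    then obtain a n where p: "p = (a, n)" "a \<in> carrier A" "n \<in> carrier N" by auto
    have "cls [p] \<in> AeM K A e T"
      using p T.asubmodule_act[OF T.asubmodule_AeM] T.act_in_AeM cls_closed
      by (simp add: cls_eq_act[OF p(2,3)])
    then show ?case
      using Cons T.asubmodule_add[OF T.asubmodule_AeM] by (simp add: cls_Cons[of _ xs])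
  qed
  then have "carrier T \<subseteq> AeM K A e T"
    by (auto elim: tensor_cases)
  then show ?thesis
    using tensor_nondegenerate T.asubmodule_subset[OF T.asubmodule_AeM[OF e_closed]]
    by (auto simp: generated_module_def)
qed

text \<open>The sum of the values of \<open>f\<close> respects every generator of
  \<open>tensor_eq\<close>, so the list stored in a class may be replaced by any other. Linearity of
  the resulting map is added in \<open>tensor_lift_hom\<close>.\<close>

lemma tensor_lift_cls:
  assumes "abelian_group M"
    and closed: "\<And>a n. \<lbrakk>a \<in> carrier A; n \<in> carrier N\<rbrakk> \<Longrightarrow> f (a, n) \<in> carrier M"
    and left: "\<And>a a' n. \<lbrakk>a \<in> carrier A; a' \<in> carrier A; n \<in> carrier N\<rbrakk>
      \<Longrightarrow> f (a \<oplus>\<^bsub>A\<^esub> a', n) = f (a, n) \<oplus>\<^bsub>M\<^esub> f (a', n)"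
    and right: "\<And>a n n'. \<lbrakk>a \<in> carrier A; n \<in> carrier N; n' \<in> carrier N\<rbrakk>
      \<Longrightarrow> f (a, n \<oplus>\<^bsub>N\<^esub> n') = f (a, n) \<oplus>\<^bsub>M\<^esub> f (a, n')"
    and bal: "\<And>a b n. \<lbrakk>a \<in> carrier A; b \<in> carrier B; n \<in> carrier N\<rbrakk>
      \<Longrightarrow> f (a \<otimes>\<^bsub>A\<^esub> b, n) = f (a, act N b n)"
    and "xs \<in> formal_sums"
  shows "tensor_lift T M f (cls xs) = list_add M f xs"
proof -
  interpret M: abelian_group M by fact
  have closed': "f p \<in> carrier M" if "p \<in> carrier A \<times> carrier N" for p
    using that closed by auto
  \<comment> \<open>For the generator \<open>tensor_zero\<close>: additivity in the left variable
    forces the value 0.\<close>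
  have zero: "f (\<zero>\<^bsub>A\<^esub>, n) = \<zero>\<^bsub>M\<^esub>" if "n \<in> carrier N" for n
    using that by (intro additive_zero[where f = "\<lambda>a. f (a, n)"])
        (auto simp: closed left assms(1) abelian_group_A)
  note add_closed = M.list_add_closed[where P = "carrier A \<times> carrier N", OF _ closed', folded formal_sums_def]
    and add_append = M.list_add_append[where P = "carrier A \<times> carrier N", OF _ _ closed', folded formal_sums_def]
  \<comment> \<open>The induction carries membership in \<open>formal_sums\<close>, because the
    values of \<open>f\<close> on other terms are not under control; symmetry and transitivity then
    need \<open>tensor_eq_formal_sums\<close>.\<close>
  have "list_add M f xs = list_add M f ys" if "teq xs ys" "xs \<in> formal_sums" for xs ys
    using that
  proof induction
    case (tensor_sym xs ys)
    then show ?case using tensor_eq_formal_sums by metis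
  next
    case (tensor_trans xs ys zs)
    then show ?case using tensor_eq_formal_sums by metis
  next
    case (tensor_append xs xs' ys ys')
    then have "xs \<in> formal_sums" "ys \<in> formal_sums" "xs' \<in> formal_sums" "ys' \<in> formal_sums"
      using tensor_eq_formal_sums by auto
    then show ?case
      using tensor_append by (simp add: add_append)
  next
    case (tensor_commute xs ys)
    then have "xs \<in> formal_sums" "ys \<in> formal_sums" by auto
    then show ?case
      by (simp add: add_append add_closed M.a_comm)
  qed (simp_all add: closed left right bal zero M.a_assoc mult_closed N.act_closed)
  from this[OF tensor_eq_terms_of] show ?thesis
    using assms(6) by (simp add: tensor_lift_def cls_closed)
qed

text \<open>Stated for all \<open>D \<subseteq> A\<close>, because the counit of the adjunction needs \<open>D = A\<close>,
  whereas \<open>a \<otimes> n \<mapsto> (e a e) n\<close> is linear over \<open>D = eAe\<close> only.\<close>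

lemma tensor_lift_hom:
  assumes M: "left_module K D M" and D: "carrier D \<subseteq> carrier A"
    and closed: "\<And>a n. \<lbrakk>a \<in> carrier A; n \<in> carrier N\<rbrakk> \<Longrightarrow> f (a, n) \<in> carrier M"
    and left: "\<And>a a' n. \<lbrakk>a \<in> carrier A; a' \<in> carrier A; n \<in> carrier N\<rbrakk>
      \<Longrightarrow> f (a \<oplus>\<^bsub>A\<^esub> a', n) = f (a, n) \<oplus>\<^bsub>M\<^esub> f (a', n)"
    and right: "\<And>a n n'. \<lbrakk>a \<in> carrier A; n \<in> carrier N; n' \<in> carrier N\<rbrakk>
      \<Longrightarrow> f (a, n \<oplus>\<^bsub>N\<^esub> n') = f (a, n) \<oplus>\<^bsub>M\<^esub> f (a, n')"
    and bal: "\<And>a b n. \<lbrakk>a \<in> carrier A; b \<in> carrier B; n \<in> carrier N\<rbrakk>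
      \<Longrightarrow> f (a \<otimes>\<^bsub>A\<^esub> b, n) = f (a, act N b n)"
    and smult: "\<And>k a n. \<lbrakk>k \<in> carrier K; a \<in> carrier A; n \<in> carrier N\<rbrakk>
      \<Longrightarrow> f (k \<odot>\<^bsub>A\<^esub> a, n) = k \<odot>\<^bsub>M\<^esub> f (a, n)"
    and act: "\<And>d a n. \<lbrakk>d \<in> carrier D; a \<in> carrier A; n \<in> carrier N\<rbrakk>
      \<Longrightarrow> f (d \<otimes>\<^bsub>A\<^esub> a, n) = act M d (f (a, n))"
  shows "tensor_lift T M f \<in> amod_hom K D T M"
proof (rule amod_homI)
  interpret M: left_module K D M by fact
  have closed': "f p \<in> carrier M" if "p \<in> carrier A \<times> carrier N" for p
    using that closed by auto
  note add_closed = M.list_add_closed[where P = "carrier A \<times> carrier N", OF _ closed', folded formal_sums_def]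
    and add_append = M.list_add_append[where P = "carrier A \<times> carrier N", OF _ _ closed', folded formal_sums_def]
  have cls: "tensor_lift T M f (cls xs) = list_add M f xs" if "xs \<in> formal_sums" for xs
    using that by (intro tensor_lift_cls) (simp_all add: M.abelian_group_axioms closed left right bal)
  show "tensor_lift T M f \<in> carrier T \<rightarrow>\<^sub>E carrier M"
  proof
    show "tensor_lift T M f t \<in> carrier M" if "t \<in> carrier T" for t
      using that by (auto elim!: tensor_cases simp: cls add_closed)
  qed (simp add: tensor_lift_def)
  fix s assume "s \<in> carrier T"
  then obtain xs where s: "xs \<in> formal_sums" "s = cls xs"
    by (rule tensor_cases)
  show "tensor_lift T M f (s \<oplus>\<^bsub>T\<^esub> t) = tensor_lift T M f s \<oplus>\<^bsub>M\<^esub> tensor_lift T M f t"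
    if "t \<in> carrier T" for t
    using that s by (auto elim!: tensor_cases simp: tensor_add_cls cls add_append)
  \<comment> \<open>One argument for both kinds of operators: \<open>p\<close> acts on left factors
    and \<open>h\<close> on \<open>M\<close>, instantiated by a scalar and by an element of
    \<open>D\<close>.\<close>
  have map: "tensor_lift T M f (cls (map (\<lambda>(a, n). (p a, n)) xs)) = h (tensor_lift T M f s)"
    if "\<And>a. a \<in> carrier A \<Longrightarrow> p a \<in> carrier A" "\<And>x. x \<in> carrier M \<Longrightarrow> h x \<in> carrier M"
      "\<And>x y. \<lbrakk>x \<in> carrier M; y \<in> carrier M\<rbrakk> \<Longrightarrow> h (x \<oplus>\<^bsub>M\<^esub> y) = h x \<oplus>\<^bsub>M\<^esub> h y"
      "\<And>a n. \<lbrakk>a \<in> carrier A; n \<in> carrier N\<rbrakk> \<Longrightarrow> f (p a, n) = h (f (a, n))" for p h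
  proof -
    have "tensor_lift T M f (cls (map (\<lambda>(a, n). (p a, n)) xs)) = list_add M f (map (\<lambda>(a, n). (p a, n)) xs)"
      by (intro cls formal_sums_map s that)
    also have "\<dots> = h (list_add M f xs)"
      by (rule list_add_map[OF s(1)[unfolded formal_sums_def]])
        (use closed that in \<open>auto simp: M.abelian_group_axioms\<close>)
    finally show ?thesis
      by (simp add: s cls)
  qed
  show "tensor_lift T M f (k \<odot>\<^bsub>T\<^esub> s) = k \<odot>\<^bsub>M\<^esub> tensor_lift T M f s" if "k \<in> carrier K" for k
    using that map[of "\<lambda>a. k \<odot>\<^bsub>A\<^esub> a" "\<lambda>x. k \<odot>\<^bsub>M\<^esub> x"]
    by (simp add: s(2) tensor_smult_cls M.smult_r_distr smult)
  show "tensor_lift T M f (act T d s) = act M d (tensor_lift T M f s)" if "d \<in> carrier D" for d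
    using that D map[of "\<lambda>a. d \<otimes>\<^bsub>A\<^esub> a" "act M d"]
    by (simp add: s(2) tensor_act_cls M.act_closed M.act_add_right act mult_closed subset_iff)
qed

end

section \<open>Homomorphisms from \<open>Ae\<close>\<close>

text \<open>Defined for every m and not only for m in eM, so that operations on homomorphisms can be
  computed by operations on \<open>M\<close>. As x = x e on Ae, m and e m give the same
  homomorphism.\<close>

definition hom_of :: "('k, 'a) module \<Rightarrow> 'a \<Rightarrow> ('k, 'a, ('a, 'x) univ) amod \<Rightarrow> ('a, 'x) univ \<Rightarrow> ('a, 'x) univ" where
  "hom_of A e M m = Fn (\<lambda>x\<in>carrier (Ae_module A e). act M x m)"

context idempotent_corner
begin

abbreviation "Ae \<equiv> Ae_module A e"

lemma Ae_carrier: "x \<in> carrier Ae \<longleftrightarrow> x \<in> carrier A \<and> x \<otimes>\<^bsub>A\<^esub> e = x"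
proof
  assume "x \<in> carrier Ae"
  then show "x \<in> carrier A \<and> x \<otimes>\<^bsub>A\<^esub> e = x"
    by (auto simp: Ae_module_def mult_closed mult_assoc)
next
  assume "x \<in> carrier A \<and> x \<otimes>\<^bsub>A\<^esub> e = x"
  then show "x \<in> carrier Ae"
    by (auto simp: Ae_module_def intro!: exI[of _ x])
qed

lemma Ae_simps [simp]:
  "add Ae = add A" "smult Ae = smult A" "act Ae = mult A" "zero Ae = zero A"
  by (simp_all add: Ae_module_def)

lemma fn_of_hom_of: "fn_of (hom_of A e M m) e = act M e m"
  by (simp add: hom_of_def Ae_carrier)

end

locale corner_hom = idempotent_corner K A e + M: left_module K A M
  for K :: "'k ring" and A :: "('k, 'a) module" and e :: 'a and M :: "('k, 'a, 'x) umod"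
begin

abbreviation "H \<equiv> Hom_Ae K A e M"
abbreviation "hm \<equiv> hom_of A e M"

lemma hom_of_closed: "m \<in> carrier M \<Longrightarrow> hm m \<in> carrier H"
  unfolding Hom_Ae_def Let_def hom_of_def partial_object.simps
  by (intro imageI amod_homI)
    (auto simp: Ae_carrier M.act_closed M.act_add_left M.act_smult_left M.act_mult
      mult_closed mult_add_left smult_mult_left mult_assoc)

text \<open>Since x = x e on Ae, a homomorphism \<phi> satisfies \<phi>(x) = x \<phi>(e), so it is
  given by \<phi>(e), and e fixes this element because e e = e. Later computations in Hom start from
  this form.\<close>

lemma hom_cases:
  assumes "u \<in> carrier H"
  obtains m where "m \<in> carrier M" "act M e m = m" "u = hm m"
proof -
  obtain \<phi> where \<phi>: "\<phi> \<in> amod_hom K A Ae M" "u = Fn \<phi>"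
    using assms by (auto simp: Hom_Ae_def Let_def)
  have \<phi>_eq: "\<phi> x = act M x (\<phi> e)" if "x \<in> carrier Ae" for x
    using that amod_hom_act[OF \<phi>(1), of x e] by (simp add: Ae_carrier)
  show ?thesis
  proof
    show "\<phi> e \<in> carrier M" "act M e (\<phi> e) = \<phi> e"
      using \<phi>_eq[of e] amod_hom_closed[OF \<phi>(1)] by (simp_all add: Ae_carrier)
    show "u = hm (\<phi> e)"
      using amod_hom_PiE[OF \<phi>(1)] \<phi>_eq
      by (auto simp: \<phi>(2) hom_of_def fun_eq_iff PiE_iff extensional_def)
  qed
qed

lemma hom_zero: "\<zero>\<^bsub>H\<^esub> = hm \<zero>\<^bsub>M\<^esub>"
  by (auto simp: Hom_Ae_def Let_def hom_of_def Ae_carrier M.act_zero intro!: restrict_ext)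

lemma hom_add:
  "\<lbrakk>m \<in> carrier M; n \<in> carrier M\<rbrakk> \<Longrightarrow> hm m \<oplus>\<^bsub>H\<^esub> hm n = hm (m \<oplus>\<^bsub>M\<^esub> n)"
  by (auto simp: Hom_Ae_def Let_def hom_of_def Ae_carrier M.act_add_right intro!: restrict_ext)

lemma hom_smult:
  "\<lbrakk>k \<in> carrier K; m \<in> carrier M\<rbrakk> \<Longrightarrow> k \<odot>\<^bsub>H\<^esub> hm m = hm (k \<odot>\<^bsub>M\<^esub> m)"
  by (auto simp: Hom_Ae_def Let_def hom_of_def Ae_carrier M.act_smult_right intro!: restrict_ext)

lemma hom_act:
  "\<lbrakk>b \<in> carrier B; m \<in> carrier M\<rbrakk> \<Longrightarrow> act H b (hm m) = hm (act M b m)"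
  by (auto simp: Hom_Ae_def Let_def hom_of_def Ae_carrier corner_carrier M.act_mult mult_closed
      mult_assoc intro!: restrict_ext)

lemmas hom_ops = hom_zero hom_add hom_smult hom_act

lemma Hom_left_module: "left_module K B H"
proof (rule left_moduleI)
  show "cring K" ..
  show "abelian_group H"
  proof (rule abelian_groupI)
    fix u assume "u \<in> carrier H"
    then obtain m where m: "m \<in> carrier M" "u = hm m"
      by (rule hom_cases)
    then have "hm (\<ominus>\<^bsub>M\<^esub> m) \<in> carrier H" "hm (\<ominus>\<^bsub>M\<^esub> m) \<oplus>\<^bsub>H\<^esub> u = \<zero>\<^bsub>H\<^esub>"
      by (simp_all add: hom_of_closed hom_ops M.l_neg)
    then show "\<exists>v\<in>carrier H. v \<oplus>\<^bsub>H\<^esub> u = \<zero>\<^bsub>H\<^esub>" by blast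
  qed (auto elim!: hom_cases simp: hom_ops hom_of_closed M.add.m_ac)
qed (auto elim!: hom_cases simp: hom_ops corner_ops_closed hom_of_closed M.act_closed M.smult_l_distr M.smult_r_distr
      M.smult_assoc1 M.act_add_left M.act_add_right M.act_mult M.act_smult_left M.act_smult_right)

lemma Hom_corner_module: "corner_module K A e H"
proof (intro corner_module.intro corner_module_axioms.intro Hom_left_module idempotent_corner_axioms)
  show "act H e u = u" if "u \<in> carrier H" for u
    using that by (auto elim!: hom_cases simp: hom_ops)
qed

end

lemma (in idempotent_corner) corner_homI: "left_module K A M \<Longrightarrow> corner_hom K A e M"
  by (simp add: corner_hom_def idempotent_corner_axioms)

lemma (in idempotent_corner) corner_module_iff: "corner_module K A e N \<longleftrightarrow> unital_module K B N"
  by (simp add: corner_module_def corner_module_axioms_def unital_module_def Ball_def idempotent_corner_axioms)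

section \<open>The counit and the inverse of the unit\<close>

definition counit :: "'k ring \<Rightarrow> ('k, 'a) module \<Rightarrow> 'a \<Rightarrow> ('k, 'a, 'x) umod \<Rightarrow> ('a, 'x) univ \<Rightarrow> ('a, 'x) univ" where
  "counit K A e M = tensor_lift (tensor A (corner A e) (Hom_Ae K A e M)) M (\<lambda>(a, u). act M a (fn_of u e))"

text \<open>The map \<open>a \<otimes> n \<mapsto> (e a e) n\<close> restricts to the inverse of \<open>N \<rightarrow> e (A \<otimes> N)\<close>, \<open>n \<mapsto> e \<otimes> n\<close>.\<close>

definition retract :: "('k, 'a) module \<Rightarrow> 'a \<Rightarrow> ('k, 'a, 'x) umod \<Rightarrow> ('a, 'x) univ \<Rightarrow> ('a, 'x) univ" where
  "retract A e N = tensor_lift (tensor A (corner A e) N) N (\<lambda>(a, n). act N (e \<otimes>\<^bsub>A\<^esub> a \<otimes>\<^bsub>A\<^esub> e) n)"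

text \<open>It runs towards \<open>N\<close>, because the composite functor is compared with the
  identity in this direction; its inverse sends n to the homomorphism with value e \<otimes> n at
  e.\<close>

definition hom_tensor_iso :: "'k ring \<Rightarrow> ('k, 'a) module \<Rightarrow> 'a \<Rightarrow> ('k, 'a, 'x) umod \<Rightarrow> ('a, 'x) univ \<Rightarrow> ('a, 'x) univ" where
  "hom_tensor_iso K A e N =
     (\<lambda>u\<in>carrier (Hom_Ae K A e (tensor A (corner A e) N)). retract A e N (fn_of u e))"

context corner_module
begin

text \<open>What lifting (a, n) \<mapsto> (e a e) n requires: additivity and scalars, balancedness
  from right eAe-linearity of a \<mapsto> e a e, and eAe-linearity of the lift from left
  eAe-linearity.\<close>

lemma ee_simps:
  "\<lbrakk>a \<in> carrier A; a' \<in> carrier A\<rbrakk>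
    \<Longrightarrow> e \<otimes>\<^bsub>A\<^esub> (a \<oplus>\<^bsub>A\<^esub> a') \<otimes>\<^bsub>A\<^esub> e = e \<otimes>\<^bsub>A\<^esub> a \<otimes>\<^bsub>A\<^esub> e \<oplus>\<^bsub>A\<^esub> e \<otimes>\<^bsub>A\<^esub> a' \<otimes>\<^bsub>A\<^esub> e"
  "\<lbrakk>k \<in> carrier K; a \<in> carrier A\<rbrakk> \<Longrightarrow> e \<otimes>\<^bsub>A\<^esub> (k \<odot>\<^bsub>A\<^esub> a) \<otimes>\<^bsub>A\<^esub> e = k \<odot>\<^bsub>A\<^esub> (e \<otimes>\<^bsub>A\<^esub> a \<otimes>\<^bsub>A\<^esub> e)"
  "\<lbrakk>a \<in> carrier A; b \<in> carrier B\<rbrakk> \<Longrightarrow> e \<otimes>\<^bsub>A\<^esub> (a \<otimes>\<^bsub>A\<^esub> b) \<otimes>\<^bsub>A\<^esub> e = (e \<otimes>\<^bsub>A\<^esub> a \<otimes>\<^bsub>A\<^esub> e) \<otimes>\<^bsub>A\<^esub> b"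
  "\<lbrakk>a \<in> carrier A; b \<in> carrier B\<rbrakk> \<Longrightarrow> e \<otimes>\<^bsub>A\<^esub> (b \<otimes>\<^bsub>A\<^esub> a) \<otimes>\<^bsub>A\<^esub> e = b \<otimes>\<^bsub>A\<^esub> (e \<otimes>\<^bsub>A\<^esub> a \<otimes>\<^bsub>A\<^esub> e)"
proof -
  show "e \<otimes>\<^bsub>A\<^esub> (a \<otimes>\<^bsub>A\<^esub> b) \<otimes>\<^bsub>A\<^esub> e = (e \<otimes>\<^bsub>A\<^esub> a \<otimes>\<^bsub>A\<^esub> e) \<otimes>\<^bsub>A\<^esub> b" if "a \<in> carrier A" "b \<in> carrier B"
    using that by (simp add: corner_carrier mult_assoc mult_closed)
  show "e \<otimes>\<^bsub>A\<^esub> (b \<otimes>\<^bsub>A\<^esub> a) \<otimes>\<^bsub>A\<^esub> e = b \<otimes>\<^bsub>A\<^esub> (e \<otimes>\<^bsub>A\<^esub> a \<otimes>\<^bsub>A\<^esub> e)" if "a \<in> carrier A" "b \<in> carrier B"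
    using that by (simp add: corner_carrier mult_closed flip: mult_assoc)
qed (simp_all add: mult_add_left mult_add_right mult_closed smult_mult_left smult_mult_right)

lemma retract_hom: "retract A e N \<in> amod_hom K B T N"
  unfolding retract_def
  by (rule tensor_lift_hom)
    (auto simp: N.left_module_axioms ee_simps N.act_closed N.act_add_right
      N.act_add_left[simplified] N.act_mult[simplified] N.act_smult_left[simplified])

lemma retract_cls:
  "xs \<in> formal_sums \<Longrightarrow>
    retract A e N (cls xs) = list_add N (\<lambda>(a, n). act N (e \<otimes>\<^bsub>A\<^esub> a \<otimes>\<^bsub>A\<^esub> e) n) xs"
  unfolding retract_def
  by (rule tensor_lift_cls)
    (auto simp: N.abelian_group_axioms ee_simps N.act_closed N.act_add_right
      N.act_add_left[simplified] N.act_mult[simplified])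

lemma retract_e: "n \<in> carrier N \<Longrightarrow> retract A e N (cls [(e, n)]) = n"
  by (simp add: retract_cls act_e_N)

text \<open>On an elementary tensor, e a \<otimes> n = e a \<otimes> e n = e a e \<otimes> n = e
  \<otimes> (e a e) n. So e t is determined by the value of \<open>retract\<close> at t, which
  yields both the injectivity of \<open>hom_tensor_iso\<close> and the vanishing of e on the kernel
  of the counit.\<close>

lemma act_e_tensor:
  assumes "t \<in> carrier T"
  shows "act T e t = cls [(e, retract A e N t)]"
proof -
  have *: "act T e (cls xs) = cls [(e, retract A e N (cls xs))]" if "xs \<in> formal_sums" for xs
    using that
  proof (induction xs)
    case Nil
    then show ?case
      by (simp add: tensor_act_cls retract_cls cls_zero_right) (simp add: tensor_zero_cls)
  next
    case (Cons p xs)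
    then obtain a n where p: "p = (a, n)" "a \<in> carrier A" "n \<in> carrier N" by auto
    let ?a = "e \<otimes>\<^bsub>A\<^esub> a \<otimes>\<^bsub>A\<^esub> e"
    have "retract A e N (cls (p # xs)) = act N ?a n \<oplus>\<^bsub>N\<^esub> retract A e N (cls xs)"
      using Cons.prems p by (simp add: retract_cls)
    moreover have "retract A e N (cls xs) \<in> carrier N"
      using Cons.prems by (simp add: amod_hom_closed[OF retract_hom] cls_closed)
    ultimately have "cls [(e, retract A e N (cls (p # xs)))] =
        cls [(e, act N ?a n)] \<oplus>\<^bsub>T\<^esub> act T e (cls xs)"
      using Cons p by (simp add: cls_add_right N.act_closed)
    also have "cls [(e, act N ?a n)] = cls [(e \<otimes>\<^bsub>A\<^esub> ?a, n)]"
      using p by (simp add: cls_balanced)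
    also have "e \<otimes>\<^bsub>A\<^esub> ?a = (e \<otimes>\<^bsub>A\<^esub> a) \<otimes>\<^bsub>A\<^esub> e"
      using p by (simp add: mult_closed flip: mult_assoc)
    also have "cls [((e \<otimes>\<^bsub>A\<^esub> a) \<otimes>\<^bsub>A\<^esub> e, n)] = act T e (cls [p])"
      using p cls_balanced[of "e \<otimes>\<^bsub>A\<^esub> a" e n] by (simp add: mult_closed act_e_N tensor_act_cls)
    also have "act T e (cls [p]) \<oplus>\<^bsub>T\<^esub> act T e (cls xs) = act T e (cls (p # xs))"
      using Cons.prems p by (simp add: tensor_act_cls tensor_add_cls)
    finally show ?case ..
  qed
  then show ?thesis
    using assms by (auto elim: tensor_cases)
qed

lemma corner_hom_tensor: "corner_hom K A e T"
  by (rule corner_homI[OF tensor_left_module])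

lemma hom_tensor_iso_hom_of:
  assumes "t \<in> carrier T" "act T e t = t"
  shows "hom_tensor_iso K A e N (hom_of A e T t) = retract A e N t"
proof -
  interpret T: corner_hom K A e T by (rule corner_hom_tensor)
  show ?thesis
    using assms by (simp add: hom_tensor_iso_def T.hom_of_closed fn_of_hom_of)
qed

lemma hom_tensor_iso_isomorphism:
  "isomorphism (full_module_category K B Ms) (Hom_Ae K A e T) N (hom_tensor_iso K A e N)"
proof (rule isomorphism_full_module_category)
  interpret T: corner_hom K A e T by (rule corner_hom_tensor)
  show "left_module K B T.H" by (rule T.Hom_left_module)
  show "left_module K B N" ..
  note ret = amod_homD[OF retract_hom]
  show "hom_tensor_iso K A e N \<in> amod_hom K B T.H N"
  proof (rule amod_homI)
    show "hom_tensor_iso K A e N \<in> carrier T.H \<rightarrow>\<^sub>E carrier N"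
    proof
      show "hom_tensor_iso K A e N u \<in> carrier N" if "u \<in> carrier T.H" for u
        using that by (auto elim!: T.hom_cases simp: hom_tensor_iso_hom_of ret)
    qed (simp add: hom_tensor_iso_def)
  next
    fix u v assume "u \<in> carrier T.H" "v \<in> carrier T.H"
    then show "hom_tensor_iso K A e N (u \<oplus>\<^bsub>T.H\<^esub> v) = hom_tensor_iso K A e N u \<oplus>\<^bsub>N\<^esub> hom_tensor_iso K A e N v"
      by (auto elim!: T.hom_cases simp: T.hom_ops hom_tensor_iso_hom_of ret T.act_add_right)
  next
    fix k u assume "k \<in> carrier K" "u \<in> carrier T.H"
    then show "hom_tensor_iso K A e N (k \<odot>\<^bsub>T.H\<^esub> u) = k \<odot>\<^bsub>N\<^esub> hom_tensor_iso K A e N u"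
      by (auto elim!: T.hom_cases simp: T.hom_ops hom_tensor_iso_hom_of ret T.act_smult_right)
  next
    fix b u assume "b \<in> carrier B" "u \<in> carrier T.H"
    \<comment> \<open>\<open>hom_tensor_iso_hom_of\<close> asks for elements fixed by e; b t is one
      because e b = b.\<close>
    moreover have "act T e (act T b t) = act T b t" if "t \<in> carrier T" for t
      using that \<open>b \<in> carrier B\<close> by (simp add: corner_carrier flip: T.act_mult)
    ultimately show "hom_tensor_iso K A e N (act T.H b u) = act N b (hom_tensor_iso K A e N u)"
      by (auto elim!: T.hom_cases simp: T.hom_ops hom_tensor_iso_hom_of ret T.act_closed)
  qed
  show "bij_betw (hom_tensor_iso K A e N) (carrier T.H) (carrier N)"
  proof (rule bij_betwI')
    fix u v assume "u \<in> carrier T.H" "v \<in> carrier T.H"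
    then obtain s t where s: "s \<in> carrier T" "act T e s = s" "u = T.hm s"
      and t: "t \<in> carrier T" "act T e t = t" "v = T.hm t"
      by (meson T.hom_cases)
    show "hom_tensor_iso K A e N u = hom_tensor_iso K A e N v \<longleftrightarrow> u = v"
    proof
      assume "hom_tensor_iso K A e N u = hom_tensor_iso K A e N v"
      \<comment> \<open>Equal values under \<open>retract\<close> give e s = e t by
        \<open>act_e_tensor\<close>, and e fixes both s and t.\<close>
      then have "act T e s = act T e t"
        using s t by (simp only: act_e_tensor hom_tensor_iso_hom_of)
      then show "u = v"
        using s t by simp
    qed simp
  next
    fix n assume n: "n \<in> carrier N"
    \<comment> \<open>The preimage of n comes from the unit, n \<mapsto> e \<otimes> n.\<close>
    let ?t = "cls [(e, n)]"
    have t: "?t \<in> carrier T"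
      using n by (simp add: cls_closed)
    moreover have "act T e ?t = ?t"
      using n act_e_tensor[OF t] by (simp add: retract_e)
    ultimately show "\<exists>u\<in>carrier T.H. n = hom_tensor_iso K A e N u"
      using n by (intro bexI[of _ "T.hm ?t"]) (simp_all add: hom_tensor_iso_hom_of retract_e T.hom_of_closed)
  next
    fix u assume "u \<in> carrier T.H"
    then show "hom_tensor_iso K A e N u \<in> carrier N"
      by (auto elim!: T.hom_cases simp: hom_tensor_iso_hom_of ret)
  qed
qed

end

context corner_hom
begin

lemma fn_of_hom:
  assumes "u \<in> carrier H"
  shows "fn_of u e \<in> carrier M" "hm (fn_of u e) = u"
  using assms by (auto elim!: hom_cases simp: fn_of_hom_of)

lemma fn_of_hom_ops:
  "\<lbrakk>u \<in> carrier H; v \<in> carrier H\<rbrakk> \<Longrightarrow> fn_of (u \<oplus>\<^bsub>H\<^esub> v) e = fn_of u e \<oplus>\<^bsub>M\<^esub> fn_of v e"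
  "\<lbrakk>b \<in> carrier B; u \<in> carrier H\<rbrakk> \<Longrightarrow> fn_of (act H b u) e = act M b (fn_of u e)"
  by (auto elim!: hom_cases simp: hom_ops fn_of_hom_of M.act_add_right corner_carrier simp flip: M.act_mult)

lemma counit_hom: "counit K A e M \<in> amod_hom K A (tensor A B H) M"
proof -
  interpret H: corner_module K A e H by (rule Hom_corner_module)
  show ?thesis
    unfolding counit_def
    by (rule H.tensor_lift_hom)
      (auto simp: M.left_module_axioms fn_of_hom fn_of_hom_ops M.act_closed M.act_add_left M.act_add_right
        M.act_mult M.act_smult_left)
qed

lemma counit_cls:
  assumes "xs \<in> corner_module.formal_sums A H"
  shows "counit K A e M (tensor_class A B H xs) = list_add M (\<lambda>(a, u). act M a (fn_of u e)) xs"
proof -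
  interpret H: corner_module K A e H by (rule Hom_corner_module)
  show ?thesis
    unfolding counit_def
    by (rule H.tensor_lift_cls)
      (use assms in \<open>auto simp: M.abelian_group_axioms fn_of_hom fn_of_hom_ops M.act_closed M.act_add_left
        M.act_add_right M.act_mult\<close>)
qed

text \<open>The two membership hypotheses do different work: the one for the tensor product makes
  the kernel vanish, the one for \<open>M\<close> makes the image everything.\<close>

lemma counit_isomorphism:
  assumes M: "M \<in> Obj (Mod_e K A e)" and T: "tensor A B H \<in> Obj (Mod_e K A e)"
  shows "isomorphism (full_module_category K A Ms) (tensor A B H) M (counit K A e M)"
proof (rule isomorphism_full_module_category[OF _ _ counit_hom])
  interpret H: corner_module K A e H by (rule Hom_corner_module)
  let ?f = "counit K A e M"
  let ?L = "{t \<in> carrier H.T. ?f t = \<zero>\<^bsub>M\<^esub>}"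
  show "left_module K A H.T" "left_module K A M" ..
  have counit_e: "?f (H.cls [(e, u)]) = fn_of u e" if "u \<in> carrier H" for u
    using that by (auto elim!: hom_cases simp: counit_cls fn_of_hom_of hom_of_closed M.act_closed simp flip: M.act_mult)
  have "?L = {\<zero>\<^bsub>H.T\<^esub>}"
  proof (rule Mod_e_eqI[OF T])
    show "asubmodule K A ?L H.T"
      by (rule H.T.asubmodule_kernel[OF M.left_module_axioms counit_hom])
    then show "{\<zero>\<^bsub>H.T\<^esub>} \<subseteq> ?L"
      using H.T.asubmodule_zero by blast
    show "asubmodule K A {\<zero>\<^bsub>H.T\<^esub>} H.T"
      by (rule H.T.asubmodule_trivial)
    fix t assume t: "t \<in> ?L"
    \<comment> \<open>With this u, e t = e \<otimes> u. The counit sends it to u(e), and by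
      linearity to e 0 = 0; hence u = 0 and e t = e \<otimes> 0 = 0.\<close>
    let ?u = "retract A e H t"
    have u: "?u \<in> carrier H"
      using t by (simp add: amod_hom_closed[OF H.retract_hom])
    have "fn_of ?u e = ?f (act H.T e t)"
      using t u by (simp add: H.act_e_tensor counit_e)
    also have "\<dots> = \<zero>\<^bsub>M\<^esub>"
      using t by (simp add: amod_hom_act[OF counit_hom] M.act_zero)
    finally have "?u = \<zero>\<^bsub>H\<^esub>"
      using fn_of_hom(2)[OF u] by (simp add: hom_zero)
    then show "act H.T e t \<in> {\<zero>\<^bsub>H.T\<^esub>}"
      using t by (simp add: H.act_e_tensor H.cls_zero_right)
  qed
  then have "inj_on ?f (carrier H.T)"
    by (intro H.T.amod_hom_inj_on[OF M.left_module_axioms counit_hom]) auto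
  moreover have "?f ` carrier H.T = carrier M"
  proof
    show "?f ` carrier H.T \<subseteq> carrier M"
      using amod_hom_closed[OF counit_hom] by auto
    \<comment> \<open>The element e m is the image of e \<otimes> \<open>hm m\<close>; the image of
      the counit, being a submodule, then contains \<open>AeM\<close>.\<close>
    have "act M e m \<in> ?f ` carrier H.T" if "m \<in> carrier M" for m
      using that counit_e[OF hom_of_closed[OF that]] H.cls_closed[of "[(e, hm m)]"]
      by (force simp: fn_of_hom_of hom_of_closed)
    then have "AeM K A e M \<subseteq> ?f ` carrier H.T"
      by (intro M.AeM_subset H.T.asubmodule_image[OF M.left_module_axioms counit_hom]) auto
    then show "carrier M \<subseteq> ?f ` carrier H.T"
      using Mod_e_eq_AeM[OF M e_closed] by simp
  qed
  ultimately show "bij_betw ?f (carrier H.T) (carrier M)"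
    by (simp add: bij_betw_def)
qed

end

section \<open>The equivalence\<close>

context idempotent_corner
begin

section \<open>Action of the two functors on arrows\<close>

lemma Hom_arr_hom_of:
  assumes "left_module K A M" "f \<in> amod_hom K A M M'" "m \<in> carrier M"
  shows "on_arr (Hom_functor K A e) M M' f (hom_of A e M m) = hom_of A e M' (f m)"
proof -
  interpret corner_hom K A e M using assms(1) by (rule corner_homI)
  show ?thesis
    using assms(3) hom_of_closed[of m]
    by (auto simp: Hom_functor_def hom_of_def compose_def Ae_carrier M.act_closed
        amod_homD[OF assms(2)] intro!: restrict_ext)
qed

lemma Hom_arr_hom:
  assumes "left_module K A M" "left_module K A M'" "f \<in> amod_hom K A M M'"
  shows "on_arr (Hom_functor K A e) M M' f \<in> amod_hom K B (Hom_Ae K A e M) (Hom_Ae K A e M')"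
proof (rule amod_homI)
  interpret M: corner_hom K A e M using assms(1) by (rule corner_homI)
  interpret M': corner_hom K A e M' using assms(2) by (rule corner_homI)
  let ?F = "on_arr (Hom_functor K A e) M M' f"
  note F = Hom_arr_hom_of[OF assms(1,3)] and f = amod_homD[OF assms(3)]
  show "?F \<in> carrier M.H \<rightarrow>\<^sub>E carrier M'.H"
  proof
    show "?F u \<in> carrier M'.H" if "u \<in> carrier M.H" for u
      using that by (auto elim!: M.hom_cases simp: F f M'.hom_of_closed)
  qed (simp add: Hom_functor_def)
  fix u assume u: "u \<in> carrier M.H"
  show "?F (u \<oplus>\<^bsub>M.H\<^esub> v) = ?F u \<oplus>\<^bsub>M'.H\<^esub> ?F v" if "v \<in> carrier M.H" for v
    using u that by (auto elim!: M.hom_cases simp: F f M.hom_ops M'.hom_ops)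
  show "?F (k \<odot>\<^bsub>M.H\<^esub> u) = k \<odot>\<^bsub>M'.H\<^esub> ?F u" if "k \<in> carrier K" for k
    using u that by (auto elim!: M.hom_cases simp: F f M.hom_ops M'.hom_ops)
  show "?F (act M.H b u) = act M'.H b (?F u)" if "b \<in> carrier B" for b
    using u that by (auto elim!: M.hom_cases simp: F f M.hom_ops M'.hom_ops M.M.act_closed)
qed

text \<open>The functor maps the stored list; passing to \<open>xs\<close> is allowed because a
  \<otimes> n \<mapsto> a \<otimes> g n respects the balancing relation, \<open>g\<close> being
  linear over eAe.\<close>

lemma tensor_arr_cls:
  assumes "corner_module K A e N" "corner_module K A e N'" "g \<in> amod_hom K B N N'"
    and "xs \<in> corner_module.formal_sums A N"
  shows "on_arr (tensor_functor A e) N N' g (tensor_class A B N xs) =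
    tensor_class A B N' (map (\<lambda>(a, n). (a, g n)) xs)"
proof -
  interpret N: corner_module K A e N by fact
  have "tensor_eq A B N' (map (\<lambda>(a, n). (a, g n)) (terms_of (N.cls xs))) (map (\<lambda>(a, n). (a, g n)) xs)"
    by (rule tensor_eq_map[where p = "\<lambda>a. a", OF tensor_eq.tensor_sym[OF tensor_eq_terms_of]])
      (simp_all add: amod_homD[OF assms(3)])
  then show ?thesis
    using assms(4) by (simp add: tensor_functor_def Let_def N.cls_closed tensor_class_eq_iff)
qed

lemma formal_sums_map_right:
  assumes "corner_module K A e N" "corner_module K A e N'" "g \<in> amod_hom K B N N'"
    and "xs \<in> corner_module.formal_sums A N"
  shows "map (\<lambda>(a, n). (a, g n)) xs \<in> corner_module.formal_sums A N'"
proof -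
  interpret N: corner_module K A e N by fact
  interpret N': corner_module K A e N' by fact
  show ?thesis
    using assms(4) by (induction xs) (auto simp: amod_homD[OF assms(3)])
qed

lemma tensor_arr_hom:
  assumes "corner_module K A e N" "corner_module K A e N'" "g \<in> amod_hom K B N N'"
  shows "on_arr (tensor_functor A e) N N' g \<in> amod_hom K A (tensor A B N) (tensor A B N')"
proof (rule amod_homI)
  interpret N: corner_module K A e N by fact
  interpret N': corner_module K A e N' by fact
  let ?G = "on_arr (tensor_functor A e) N N' g"
  note G = tensor_arr_cls[OF assms] and mem = formal_sums_map_right[OF assms]
  show "?G \<in> carrier N.T \<rightarrow>\<^sub>E carrier N'.T"
  proof
    show "?G t \<in> carrier N'.T" if "t \<in> carrier N.T" for t
      using that by (auto elim!: N.tensor_cases simp: G N'.cls_closed mem)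
  qed (simp add: tensor_functor_def Let_def)
  fix s assume "s \<in> carrier N.T"
  then obtain xs where s: "xs \<in> N.formal_sums" "s = N.cls xs"
    by (rule N.tensor_cases)
  show "?G (s \<oplus>\<^bsub>N.T\<^esub> t) = ?G s \<oplus>\<^bsub>N'.T\<^esub> ?G t" if "t \<in> carrier N.T" for t
    using s that by (auto elim!: N.tensor_cases simp: G N.tensor_add_cls N'.tensor_add_cls)
  show "?G (k \<odot>\<^bsub>N.T\<^esub> s) = k \<odot>\<^bsub>N'.T\<^esub> ?G s" if "k \<in> carrier K" for k
    using s that N.formal_sums_map[OF s(1), of "\<lambda>a. k \<odot>\<^bsub>A\<^esub> a"]
    by (simp add: G N.tensor_smult_cls N'.tensor_smult_cls comp_def case_prod_beta')
  show "?G (act N.T a s) = act N'.T a (?G s)" if "a \<in> carrier A" for a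
    using s that N.formal_sums_map[OF s(1), of "\<lambda>c. a \<otimes>\<^bsub>A\<^esub> c"]
    by (simp add: G N.tensor_act_cls N'.tensor_act_cls comp_def case_prod_beta' mult_closed)
qed

section \<open>Naturality of the counit and of the inverse unit\<close>

lemma counit_natural:
  assumes "left_module K A M" "left_module K A M'" "f \<in> amod_hom K A M M'"
    and "t \<in> carrier (tensor A B (Hom_Ae K A e M))"
  shows "counit K A e M' (on_arr (tensor_functor A e) (Hom_Ae K A e M) (Hom_Ae K A e M')
      (on_arr (Hom_functor K A e) M M' f) t) = f (counit K A e M t)"
proof -
  interpret M: corner_hom K A e M using assms(1) by (rule corner_homI)
  interpret M': corner_hom K A e M' using assms(2) by (rule corner_homI)
  interpret H: corner_module K A e M.H by (rule M.Hom_corner_module)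
  interpret H': corner_module K A e M'.H by (rule M'.Hom_corner_module)
  note f = amod_homD[OF assms(3)]
    and F = H.corner_module_axioms H'.corner_module_axioms Hom_arr_hom[OF assms(1-3)]
  obtain xs where xs: "xs \<in> H.formal_sums" "t = H.cls xs"
    using assms(4) by (rule H.tensor_cases)
  \<comment> \<open>For u given by m with e m = m, both sides equal f(m): on the left e f(m) = f(e
    m) = f(m).\<close>
  have f_fn_of: "fn_of (on_arr (Hom_functor K A e) M M' f u) e = f (fn_of u e)" if u: "u \<in> carrier M.H" for u
  proof -
    obtain m where m: "m \<in> carrier M" "act M e m = m" "u = M.hm m"
      using u by (rule M.hom_cases)
    then show ?thesis
      using f(5)[of e m] by (simp add: Hom_arr_hom_of[OF assms(1,3)] fn_of_hom_of)
  qed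
  have "list_add M' (\<lambda>(a, u). act M' a (fn_of u e))
      (map (\<lambda>(a, u). (a, on_arr (Hom_functor K A e) M M' f u)) xs) =
    f (list_add M (\<lambda>(a, u). act M a (fn_of u e)) xs)"
    by (rule list_add_map[OF xs(1)[unfolded H.formal_sums_def]])
      (auto simp: f M.M.abelian_group_axioms M'.M.abelian_group_axioms M.fn_of_hom M.M.act_closed f_fn_of)
  then show ?thesis
    using xs by (simp add: tensor_arr_cls[OF F] M'.counit_cls M.counit_cls formal_sums_map_right[OF F])
qed

lemma hom_tensor_iso_natural:
  assumes "corner_module K A e N" "corner_module K A e N'" "g \<in> amod_hom K B N N'"
    and "u \<in> carrier (Hom_Ae K A e (tensor A B N))"
  shows "hom_tensor_iso K A e N' (on_arr (Hom_functor K A e) (tensor A B N) (tensor A B N')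
      (on_arr (tensor_functor A e) N N' g) u) = g (hom_tensor_iso K A e N u)"
proof -
  interpret N: corner_module K A e N by fact
  interpret N': corner_module K A e N' by fact
  interpret T: corner_hom K A e N.T by (rule N.corner_hom_tensor)
  let ?G = "on_arr (tensor_functor A e) N N' g"
  note g = amod_homD[OF assms(3)] and G = amod_homD[OF tensor_arr_hom[OF assms(1-3)]]
  obtain t where t: "t \<in> carrier N.T" "act N.T e t = t" "u = T.hm t"
    using assms(4) by (rule T.hom_cases)
  obtain xs where xs: "xs \<in> N.formal_sums" "t = N.cls xs"
    using t(1) by (rule N.tensor_cases)
  \<comment> \<open>The image of t is again fixed by e, so \<open>hom_tensor_iso_hom_of\<close>
    applies to it.\<close>
  have "act N'.T e (?G t) = ?G t"
    using t G(5)[of e t] by simp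
  then have "hom_tensor_iso K A e N' (on_arr (Hom_functor K A e) N.T N'.T ?G u) = retract A e N' (?G t)"
    using t Hom_arr_hom_of[OF N.tensor_left_module tensor_arr_hom[OF assms(1-3)]]
    by (simp add: N'.hom_tensor_iso_hom_of G)
  also have "\<dots> = list_add N' (\<lambda>(a, n). act N' (e \<otimes>\<^bsub>A\<^esub> a \<otimes>\<^bsub>A\<^esub> e) n) (map (\<lambda>(a, n). (a, g n)) xs)"
    using xs by (simp add: tensor_arr_cls[OF assms(1-3)] N'.retract_cls formal_sums_map_right[OF assms(1-3)])
  \<comment> \<open>Termwise this is (e a e) g(n) = g((e a e) n), the linearity of \<open>g\<close>
    over eAe.\<close>
  also have "\<dots> = g (list_add N (\<lambda>(a, n). act N (e \<otimes>\<^bsub>A\<^esub> a \<otimes>\<^bsub>A\<^esub> e) n) xs)"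
    by (rule list_add_map[OF xs(1)[unfolded N.formal_sums_def]])
      (auto simp: g N.N.abelian_group_axioms N'.N.abelian_group_axioms N.N.act_closed)
  also have "\<dots> = g (hom_tensor_iso K A e N u)"
    using t xs by (simp add: N.hom_tensor_iso_hom_of N.retract_cls)
  finally show ?thesis .
qed

end

section \<open>The two categories and the functors between them\<close>

lemma Mod_e_cat [simp]:
  "Arr (Mod_e K A e) = amod_hom K A"
  "Idn (Mod_e K A e) M = (\<lambda>x\<in>carrier M. x)"
  "Cmp (Mod_e K A e) M N P g f = compose (carrier M) g f"
  by (simp_all add: Mod_e_def full_module_category_def)

lemma Mod_corner_cat [simp]:
  "Arr (Mod_corner K A e) = amod_hom K (corner A e)"
  "Idn (Mod_corner K A e) M = (\<lambda>x\<in>carrier M. x)"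
  "Cmp (Mod_corner K A e) M N P g f = compose (carrier M) g f"
  by (simp_all add: Mod_corner_def full_module_category_def)

context idempotent_corner
begin

lemma Mod_corner_Obj: "N \<in> Obj (Mod_corner K A e) \<longleftrightarrow> corner_module K A e N"
  by (simp add: Mod_corner_def full_module_category_def corner_module_iff)

lemma is_category_Mod_e: "is_category (Mod_e K A e)"
  unfolding Mod_e_def
  by (rule is_category_full_module_category) (auto simp: nondegenerate_module_def)

lemma is_category_Mod_corner: "is_category (Mod_corner K A e)"
  unfolding Mod_corner_def
  by (rule is_category_full_module_category) (auto simp: unital_module_def)

lemma is_functor_Hom:
  "is_functor (Mod_e K A e) (Mod_corner K A e) (Hom_functor K A e)"
proof (intro is_functor.intro is_functor_axioms.intro is_category_Mod_e is_category_Mod_corner)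
  let ?C = "Mod_e K A e :: (('k, 'a, 'x) umod, ('a, 'x) univ \<Rightarrow> ('a, 'x) univ) cat"
  let ?F = "Hom_functor K A e"
  have on_obj: "on_obj ?F = Hom_Ae K A e"
    by (simp add: Hom_functor_def)
  fix X Y Z f g
  assume X: "X \<in> Obj ?C"
  interpret X: corner_hom K A e X using Mod_eD(2)[OF X] by (rule corner_homI)
  note ops = on_obj Mod_corner_Obj Mod_eD(2) X.Hom_corner_module
  show "on_obj ?F X \<in> Obj (Mod_corner K A e)"
    by (simp add: ops)
  show "on_arr ?F X X (Idn ?C X) = Idn (Mod_corner K A e) (on_obj ?F X)"
  proof
    \<comment> \<open>Arrows are compared as functions on the whole universe; outside the carrier
      both sides are \<open>undefined\<close>.\<close>
    show "on_arr ?F X X (Idn ?C X) u = Idn (Mod_corner K A e) (on_obj ?F X) u" for u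
      using Hom_arr_hom_of[OF X.M.left_module_axioms X.M.amod_hom_identity]
      by (cases "u \<in> carrier X.H") (auto simp: on_obj elim!: X.hom_cases, simp add: Hom_functor_def)
  qed
  assume Y: "Y \<in> Obj ?C" and f: "f \<in> Arr ?C X Y"
  interpret Y: corner_hom K A e Y using Mod_eD(2)[OF Y] by (rule corner_homI)
  show "on_arr ?F X Y f \<in> Arr (Mod_corner K A e) (on_obj ?F X) (on_obj ?F Y)"
    using f by (simp add: on_obj Hom_arr_hom X.M.left_module_axioms Y.M.left_module_axioms)
  assume Z: "Z \<in> Obj ?C" and g: "g \<in> Arr ?C Y Z"
  have gf: "compose (carrier X) g f \<in> amod_hom K A X Z"
    using f g by (simp add: amod_hom_compose[OF X.M.left_module_axioms])
  show "on_arr ?F X Z (Cmp ?C X Y Z g f) =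
      Cmp (Mod_corner K A e) (on_obj ?F X) (on_obj ?F Y) (on_obj ?F Z) (on_arr ?F Y Z g) (on_arr ?F X Y f)"
  proof
    fix u
    show "on_arr ?F X Z (Cmp ?C X Y Z g f) u =
      Cmp (Mod_corner K A e) (on_obj ?F X) (on_obj ?F Y) (on_obj ?F Z) (on_arr ?F Y Z g) (on_arr ?F X Y f) u"
    proof (cases "u \<in> carrier X.H")
      case True
      then show ?thesis
        using f g gf
        by (auto elim!: X.hom_cases simp: on_obj compose_eq X.hom_of_closed amod_hom_closed
            Hom_arr_hom_of X.M.left_module_axioms Y.M.left_module_axioms)
    qed (simp add: on_obj compose_def Hom_functor_def)
  qed
qed

lemma is_functor_tensor:
  assumes "left_special TYPE('x) K A e"
  shows "is_functor (Mod_corner K A e) (Mod_e K A e)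
    (tensor_functor A e :: (('k, 'a, 'x) umod, ('a, 'x) univ \<Rightarrow> ('a, 'x) univ,
       ('k, 'a, 'x) umod, ('a, 'x) univ \<Rightarrow> ('a, 'x) univ) ftor)"
proof (intro is_functor.intro is_functor_axioms.intro is_category_Mod_e is_category_Mod_corner)
  let ?D = "Mod_corner K A e :: (('k, 'a, 'x) umod, ('a, 'x) univ \<Rightarrow> ('a, 'x) univ) cat"
  let ?G = "tensor_functor A e :: (('k, 'a, 'x) umod, ('a, 'x) univ \<Rightarrow> ('a, 'x) univ,
       ('k, 'a, 'x) umod, ('a, 'x) univ \<Rightarrow> ('a, 'x) univ) ftor"
  have on_obj: "on_obj ?G = tensor A B"
    by (simp add: tensor_functor_def Let_def)
  fix X Y Z f g
  assume X: "X \<in> Obj ?D"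
  interpret X: corner_module K A e X using X by (simp add: Mod_corner_Obj)
  \<comment> \<open>Left speciality places A \<otimes> X in M(A)_e and not merely among the modules
    generated by their e-part.\<close>
  show "on_obj ?G X \<in> Obj (Mod_e K A e)"
    by (simp add: on_obj Mod_e_if_left_special[OF assms] X.tensor_generated)
  \<comment> \<open>The identity arrow is restricted to the carrier, so its values are conditionals;
    on formal sums these collapse.\<close>
  have id_map: "map (\<lambda>(a, n). (a, if n \<in> carrier X then n else undefined)) xs = xs" if "xs \<in> X.formal_sums" for xs
    using that by (induction xs) auto
  show "on_arr ?G X X (Idn ?D X) = Idn (Mod_e K A e) (on_obj ?G X)"
  proof
    fix t
    show "on_arr ?G X X (Idn ?D X) t = Idn (Mod_e K A e) (on_obj ?G X) t"
    proof (cases "t \<in> carrier X.T")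
      case True
      then obtain xs where "xs \<in> X.formal_sums" "t = X.cls xs" by (rule X.tensor_cases)
      then show ?thesis
        using tensor_arr_cls[OF X.corner_module_axioms X.corner_module_axioms X.N.amod_hom_identity]
        by (simp only: on_obj id_map Mod_corner_cat Mod_e_cat restrict_apply X.cls_closed if_True)
    qed (simp add: on_obj tensor_functor_def Let_def)
  qed
  assume Y: "Y \<in> Obj ?D" and f: "f \<in> Arr ?D X Y"
  interpret Y: corner_module K A e Y using Y by (simp add: Mod_corner_Obj)
  show "on_arr ?G X Y f \<in> Arr (Mod_e K A e) (on_obj ?G X) (on_obj ?G Y)"
    using f by (simp add: on_obj tensor_arr_hom X.corner_module_axioms Y.corner_module_axioms)
  assume Z: "Z \<in> Obj ?D" and g: "g \<in> Arr ?D Y Z"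
  interpret Z: corner_module K A e Z using Z by (simp add: Mod_corner_Obj)
  have f': "f \<in> amod_hom K B X Y" and g': "g \<in> amod_hom K B Y Z"
    using f g by simp_all
  have gf: "compose (carrier X) g f \<in> amod_hom K B X Z"
    using amod_hom_compose[OF X.N.left_module_axioms f' g'] .
  \<comment> \<open>Composition is restricted to the carrier too, so this factorisation is stated
    for formal sums.\<close>
  have comp_map: "map (\<lambda>(a, n). (a, compose (carrier X) g f n)) xs =
      map (\<lambda>(a, n). (a, g n)) (map (\<lambda>(a, n). (a, f n)) xs)" if "xs \<in> X.formal_sums" for xs
    using that by (induction xs) (auto simp: compose_eq)
  note arr = tensor_arr_cls[OF X.corner_module_axioms Z.corner_module_axioms gf]
    tensor_arr_cls[OF X.corner_module_axioms Y.corner_module_axioms f']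
    tensor_arr_cls[OF Y.corner_module_axioms Z.corner_module_axioms g']
    formal_sums_map_right[OF X.corner_module_axioms Y.corner_module_axioms f']
  show "on_arr ?G X Z (Cmp ?D X Y Z g f) =
      Cmp (Mod_e K A e) (on_obj ?G X) (on_obj ?G Y) (on_obj ?G Z) (on_arr ?G Y Z g) (on_arr ?G X Y f)"
  proof
    fix t
    show "on_arr ?G X Z (Cmp ?D X Y Z g f) t =
      Cmp (Mod_e K A e) (on_obj ?G X) (on_obj ?G Y) (on_obj ?G Z) (on_arr ?G Y Z g) (on_arr ?G X Y f) t"
    proof (cases "t \<in> carrier X.T")
      case True
      then obtain xs where "xs \<in> X.formal_sums" "t = X.cls xs" by (rule X.tensor_cases)
      then show ?thesis
        by (simp add: on_obj compose_eq X.cls_closed arr comp_map del: map_map)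
    qed (simp add: on_obj compose_def tensor_functor_def Let_def)
  qed
qed

end

theorem theorem3p10:
  fixes K :: "'k ring" and A :: "('k, 'a) module" and e :: 'a
  assumes "idempotented_algebra K A"
    and "idempotent_elem A e"
    and "left_special TYPE('x) K A e"
  shows "equivalence_with_quasi_inverse
           (Mod_e K A e :: (('k, 'a, 'x) umod, ('a, 'x) univ \<Rightarrow> ('a, 'x) univ) cat)
           (Mod_corner K A e)
           (Hom_functor K A e)
           (tensor_functor A e)"
proof -
  let ?C = "Mod_e K A e :: (('k, 'a, 'x) umod, ('a, 'x) univ \<Rightarrow> ('a, 'x) univ) cat"
  let ?D = "Mod_corner K A e :: (('k, 'a, 'x) umod, ('a, 'x) univ \<Rightarrow> ('a, 'x) univ) cat"
  let ?F = "Hom_functor K A e" and ?G = "tensor_functor A e"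
  interpret idempotent_corner K A e
    using assms by (simp add: idempotent_corner_def idempotent_corner_axioms_def)
  have F_obj: "on_obj ?F = Hom_Ae K A e" and G_obj: "on_obj ?G = tensor A B"
    by (simp_all add: Hom_functor_def tensor_functor_def Let_def)
  have "natural_isomorphism ?C ?C (comp_ftor ?G ?F) id_ftor (counit K A e)"
    unfolding natural_isomorphism_def comp_ftor_def id_ftor_def ftor.simps F_obj G_obj
  proof (intro conjI ballI)
    fix M assume M: "M \<in> Obj ?C"
    interpret M: corner_hom K A e M using Mod_eD(2)[OF M] by (rule corner_homI)
    interpret H: corner_module K A e M.H by (rule M.Hom_corner_module)
    \<comment> \<open>The second premise of \<open>counit_isomorphism\<close>. The tensor product
      lives in the same universe type as \<open>M\<close>, so the given instance of left speciality
      applies to it.\<close>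
    have "H.T \<in> Obj ?C"
      by (simp add: Mod_e_if_left_special[OF assms(3)] H.tensor_generated)
    then show "isomorphism ?C H.T M (counit K A e M)"
      using M.counit_isomorphism[OF M] by (simp add: Mod_e_def)
    fix M' f assume "M' \<in> Obj ?C" "f \<in> Arr ?C M M'"
    then show "Cmp ?C H.T (tensor A B (Hom_Ae K A e M')) M' (counit K A e M')
        (on_arr ?G M.H (Hom_Ae K A e M') (on_arr ?F M M' f)) =
      Cmp ?C H.T M M' f (counit K A e M)"
      by (auto simp: compose_def counit_natural M.M.left_module_axioms Mod_eD(2) intro!: restrict_ext)
  qed
  moreover have "natural_isomorphism ?D ?D (comp_ftor ?F ?G) id_ftor (hom_tensor_iso K A e)"
    unfolding natural_isomorphism_def comp_ftor_def id_ftor_def ftor.simps F_obj G_obj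
  proof (intro conjI ballI)
    fix N assume "N \<in> Obj ?D"
    then interpret N: corner_module K A e N by (simp add: Mod_corner_Obj)
    show "isomorphism ?D (Hom_Ae K A e N.T) N (hom_tensor_iso K A e N)"
      unfolding Mod_corner_def by (rule N.hom_tensor_iso_isomorphism)
    fix N' g assume "N' \<in> Obj ?D" "g \<in> Arr ?D N N'"
    then show "Cmp ?D (Hom_Ae K A e N.T) (Hom_Ae K A e (tensor A B N')) N' (hom_tensor_iso K A e N')
        (on_arr ?F N.T (tensor A B N') (on_arr ?G N N' g)) =
      Cmp ?D (Hom_Ae K A e N.T) N N' g (hom_tensor_iso K A e N)"
      by (auto simp: compose_def hom_tensor_iso_natural N.corner_module_axioms Mod_corner_Obj
          intro!: restrict_ext)
  qed
  ultimately show ?thesis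
    using is_functor_Hom is_functor_tensor[OF assms(3)]
    unfolding equivalence_with_quasi_inverse_def by blast
qed

end
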